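(* Suppose Assumptions (A1)–(A4) hold, and let $\kappa_2,\alpha,\beta,\eta$ and $\epsilon_1,\dots,\epsilon_8$ be exactly as in Theorem 1 (i.e. $\kappa_2>1$, $\beta>\max\{\frac{\kappa_1}{\kappa_2-1},\kappa_3,\kappa_4\}$, $\alpha\in(\beta+\kappa_1,\kappa_2\beta]$, $\eta\in(0,\min\{\epsilon_1/\epsilon_2,\epsilon_3/\epsilon_4,\epsilon_5/\epsilon_6\})$). Define $\epsilon_9=\min\{\frac{1}{2\rho(L)},\frac{\alpha-\beta}{2\alpha}\}$, $\epsilon_{10}=\eta\min\{\epsilon_1-\eta\epsilon_2,\ \epsilon_3-\eta\epsilon_4,\ \frac\nu2\}$, $\epsilon=\epsilon_{10}/\epsilon_8$, $c=\epsilon_8\hat V_0/\epsilon_9$. Let $\{\boldsymbol x_k\}$ be generated by Algorithm 1. Then for all $k\in\mathbb N_0$, $$\|\boldsymbol x_k-\bar{\boldsymbol x}_k\|^2+n(f(\bar x_k)-f^* )\le(1-\epsilon)^kc.$$ Moreover, if the projection $\mathcal P_{\mathbb X^*}(x)=\arg\min_{y\in\mathbb X^*}\|x-y\|^2$ is well defined for all $x$, then for all $k\in\mathbb N_0$, $$\|\boldsymbol x_k-\mathbf 1_n\otimes\mathcal P_{\mathbb X^*}(\bar x_k)\|^2\le(1-\epsilon)^kc\Big(1+\frac{1}{2\nu}\Big).$$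
   Context: Same setting as Theorem 1: graph $\mathcal G$ with Laplacian $L$, $\rho(L)$ largest eigenvalue, $\rho_2(L)$ smallest positive eigenvalue; $f=\frac1n\sum_i f_i$, $\mathbb X^*=\arg\min f$, $f^*=\min f$. Assumptions: (A1) $\mathcal G$ connected; (A2) $\mathbb X^*\ne\emptyset$, $f^*>-\infty$; (A3) each $\nabla f_i$ is $L_f$-Lipschitz; (A4) $f$ satisfies the Polyak–Łojasiewicz condition with constant $\nu>0$: $\frac12\|\nabla f(x)\|^2\ge\nu(f(x)-f^* )$ for all $x\in\mathbb R^p$. Constants from Theorem 1: $\kappa_1=\frac{2+3L_f^2}{2\rho_2(L)}$, $\kappa_3=\frac14(1+(1+8\kappa_2+\frac{8}{\rho_2(L)})^{1/2})$, $\kappa_4=(\kappa_2+\frac1{\rho_2(L)})L_f^2+((\kappa_2+\frac1{\rho_2(L)})^2L_f^2+2)^{1/2}L_f$, $\epsilon_1=(\alpha-\beta)\rho_2(L)-\frac12(2+3L_f^2)$, $\epsilon_2=\beta^2\rho(L)+(2\alpha^2+\beta^2)\rho^2(L)+\frac52L_f^2$, $\epsilon_3=\beta-\frac12-\frac\alpha{2\beta^2}-\frac1{2\beta\rho_2(L)}$, $\epsilon_4=2\beta^2+\frac12$, $\epsilon_5=\frac14-\frac1{2\beta}(\frac1\beta+\frac1{\rho_2(L)}+\frac\alpha\beta)L_f^2$, $\epsilon_6=\frac1{\beta^2}(1+\frac1{\rho_2(L)}+\frac\alpha\beta)L_f^2+\frac{L_f(1+L_f)}2$, $\epsilon_8=\frac{\alpha+\beta}{2\beta}+\frac1{2\rho_2(L)}$.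 Algorithm 1: $x_{i,0}$ arbitrary, $\sum_j v_{j,0}=\mathbf 0_p$, $x_{i,k+1}=x_{i,k}-\eta(\alpha\sum_jL_{ij}x_{j,k}+\beta v_{i,k}+\nabla f_i(x_{i,k}))$, $v_{i,k+1}=v_{i,k}+\eta\beta\sum_jL_{ij}x_{j,k}$. Notation: $\boldsymbol x_k=\mathrm{col}(x_{i,k})$, $\boldsymbol v_k=\mathrm{col}(v_{i,k})$, $\bar x_k=\frac1n\sum_ix_{i,k}$, $\bar{\boldsymbol x}_k=\mathbf 1_n\otimes\bar x_k$, $\boldsymbol K=(I_n-\frac1n\mathbf 1\mathbf 1^\top)\otimes I_p$, $\|z\|^2_M=z^\top Mz$, $\boldsymbol g_k^0=\mathrm{col}(\nabla f_1(\bar x_k),\dots,\nabla f_n(\bar x_k))$, $\hat V_0=\|\boldsymbol x_0\|^2_{\boldsymbol K}+\|\boldsymbol v_0+\frac1\beta\boldsymbol g_0^0\|^2_{\boldsymbol K}+n(f(\bar x_0)-f^* )$. *)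

theory Defs
  imports "HOL-Analysis.Analysis"
begin

text \<open>Laplacian of an undirected weighted graph on the node type 'n with
  nonnegative symmetric weights a: L_ij = (if i = j then deg_i else 0) - a_ij.\<close>
definition laplacian :: "('n::finite \<Rightarrow> 'n \<Rightarrow> real) \<Rightarrow> real^'n^'n" where
  "laplacian a = (\<chi> i j. (if i = j then (\<Sum>k\<in>UNIV. a i k) else 0) - a i j)"

text \<open>Connectedness of the graph whose edges are the pairs with positive weight.\<close>
definition graph_connected :: "('n::finite \<Rightarrow> 'n \<Rightarrow> real) \<Rightarrow> bool" where
  "graph_connected a \<longleftrightarrow> (\<forall>i j. (i, j) \<in> {(u, w). a u w > 0}\<^sup>*)"

text \<open>Real eigenvalues of a real square matrix.\<close>
definition eigenvalues :: "real^'n^'n \<Rightarrow> real set" where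
  "eigenvalues M = {l. \<exists>v. v \<noteq> 0 \<and> M *v v = l *\<^sub>R v}"

text \<open>rho(L): largest eigenvalue; rho2(L): smallest positive eigenvalue.\<close>
definition rho :: "real^'n^'n \<Rightarrow> real" where
  "rho M = Max (eigenvalues M)"

definition rho2 :: "real^'n^'n \<Rightarrow> real" where
  "rho2 M = Min {l \<in> eigenvalues M. l > 0}"

text \<open>Squared K-norm of a stacked vector z = col(z_i): sum_i |z_i - mean z|^2.\<close>
definition Knorm2 :: "('n::finite \<Rightarrow> 'a::real_normed_vector) \<Rightarrow> real" where
  "Knorm2 z = (\<Sum>i\<in>UNIV. (norm (z i - (1 / real CARD('n)) *\<^sub>R (\<Sum>j\<in>UNIV. z j)))\<^sup>2)"

end

theory Submission
  imports Defs
begin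

text \<open>
  Write \<open>X\<close> for the centred iterates, \<open>W\<close> for \<open>v + g\<^sup>0 / \<beta>\<close> centred, \<open>Q\<close> for the inverse of the
  Laplacian on vectors of mean zero, and \<open>F\<close> for \<open>n (f xbar - f*)\<close>. With
  \<open>U = |X|\<^sup>2/2 + (W, QW)/2 + (\<alpha>/\<beta>) |W|\<^sup>2/2 + (X, W)\<close>, the first-order cross terms in \<open>X\<close> and \<open>W\<close> of one
  step cancel, and Young's inequality together with the Polyak--Lojasiewicz condition shows that
  \<open>U + m F\<close> contracts by the factor \<open>1 - \<epsilon>\<close> for every weight \<open>m\<close> between 1 and \<open>min 2 \<epsilon>8\<close>.
  There is room for \<open>m > 1\<close> because the centred and the averaged part of the gradient error
  are orthogonal and hence share the single bound \<open>Lf\<^sup>2 |X|\<^sup>2\<close>.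

  For the distance to the minimizers, quadratic growth gives \<open>|xbar - P xbar|\<^sup>2 \<le> (2/\<nu>) (f xbar - f*)\<close>,
  and \<open>2/\<nu>\<close> can exceed \<open>1 + 1/(2\<nu>)\<close>. The weight \<open>m = max 1 (4 \<epsilon>9)\<close> compensates for this; it is
  admissible since \<open>4 \<epsilon>9 \<le> \<epsilon>8\<close>.
\<close>

subsection \<open>The spectrum of the Laplacian\<close>

text \<open>The form is nonnegative along the line \<open>y + s z\<close>, and a quadratic
  polynomial in \<open>s\<close> without negative values has no positive discriminant. Positivity is
  asked on \<open>S\<close> only, so that the lemma can be applied to \<open>\<mu> - T\<close>
  below.\<close>

lemma psd_cauchy_schwarz:
  fixes T :: "'e::real_inner \<Rightarrow> 'e"
  assumes T: "linear T" and sym: "\<And>y z. y \<bullet> T z = T y \<bullet> z"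
    and S: "subspace S" and psd: "\<And>y. y \<in> S \<Longrightarrow> 0 \<le> y \<bullet> T y"
    and yz: "y \<in> S" "z \<in> S"
  shows "(y \<bullet> T z)\<^sup>2 \<le> (y \<bullet> T y) * (z \<bullet> T z)"
proof -
  have q: "0 \<le> (y \<bullet> T y) + 2 * s * (y \<bullet> T z) + s\<^sup>2 * (z \<bullet> T z)" for s
  proof -
    have "y + s *\<^sub>R z \<in> S" using S yz by (simp add: subspace_add subspace_mul)
    then have "0 \<le> (y + s *\<^sub>R z) \<bullet> T (y + s *\<^sub>R z)" by (rule psd)
    also have "\<dots> = (y \<bullet> T y) + 2 * s * (y \<bullet> T z) + s\<^sup>2 * (z \<bullet> T z)"
      using sym[of z y]
      by (simp add: linear_add[OF T] linear_scale[OF T] inner_add inner_commute power2_eq_square algebra_simps)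
    finally show ?thesis .
  qed
  show ?thesis
  proof (cases "z \<bullet> T z = 0")
    case True
    have "y \<bullet> T z = 0"
    proof (rule ccontr)
      assume n: "y \<bullet> T z \<noteq> 0"
      \<comment> \<open>With \<open>z \<bullet> T z = 0\<close> the polynomial is affine in
        \<open>s\<close>; this \<open>s\<close> gives it the value -1.\<close>
      have "0 \<le> (y \<bullet> T y) + 2 * (- ((y \<bullet> T y) + 1) / (2 * (y \<bullet> T z))) * (y \<bullet> T z)"
        using q[of "- ((y \<bullet> T y) + 1) / (2 * (y \<bullet> T z))"] True by simp
      then show False using n by (simp add: field_simps)
    qed
    then show ?thesis using True by simp
  next
    case False
    then have pos: "0 < z \<bullet> T z" using psd[OF yz(2)] by simp
    \<comment> \<open>This \<open>s\<close> minimizes the quadratic polynomial.\<close>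
    have "0 \<le> (y \<bullet> T y) + 2 * (- (y \<bullet> T z) / (z \<bullet> T z)) * (y \<bullet> T z) + (- (y \<bullet> T z) / (z \<bullet> T z))\<^sup>2 * (z \<bullet> T z)"
      by (rule q)
    also have "\<dots> = (y \<bullet> T y) - (y \<bullet> T z)\<^sup>2 / (z \<bullet> T z)"
      using pos by (simp add: field_simps power2_eq_square)
    finally show ?thesis using pos by (simp add: field_simps)
  qed
qed

text \<open>Maximize the Rayleigh quotient over the compact unit sphere of \<open>S\<close>. The
  invariant subspace is part of the statement because the second smallest eigenvalue of the
  Laplacian is extremal only on the mean-zero vectors.\<close>

lemma exists_max_eigenvector:
  fixes T :: "'e::euclidean_space \<Rightarrow> 'e"
  assumes T: "linear T" and sym: "\<And>y z. y \<bullet> T z = T y \<bullet> z"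
    and S: "subspace S" and inv: "\<And>y. y \<in> S \<Longrightarrow> T y \<in> S"
    and nontriv: "\<exists>y\<in>S. y \<noteq> 0"
  obtains u \<mu> where "u \<in> S" "u \<noteq> 0" "T u = \<mu> *\<^sub>R u" "\<And>y. y \<in> S \<Longrightarrow> y \<bullet> T y \<le> \<mu> * (y \<bullet> y)"
proof -
  define K where "K = S \<inter> sphere 0 1"
  have "compact K" unfolding K_def
    using closed_subspace[OF S] by (simp add: closed_Int_compact)
  moreover obtain w where w: "w \<in> S" "w \<noteq> 0" using nontriv by blast
  then have "(1 / norm w) *\<^sub>R w \<in> K" using S by (simp add: K_def subspace_mul)
  then have "K \<noteq> {}" by blast
  moreover have "continuous_on K (\<lambda>y. y \<bullet> T y)"
    using T by (intro continuous_on_inner continuous_on_id linear_continuous_on) (simp add: linear_conv_bounded_linear)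
  ultimately obtain u where u: "u \<in> K" "\<And>y. y \<in> K \<Longrightarrow> y \<bullet> T y \<le> u \<bullet> T u"
    using continuous_attains_sup[of K "\<lambda>y. y \<bullet> T y"] by blast
  define \<mu> where "\<mu> = u \<bullet> T u"
  have uS: "u \<in> S" and nu: "norm u = 1" using u(1) by (auto simp: K_def)
  have uu: "u \<bullet> u = 1" using nu by (simp add: dot_square_norm)
  have bound: "y \<bullet> T y \<le> \<mu> * (y \<bullet> y)" if y: "y \<in> S" for y
  proof (cases "y = 0")
    case True
    then show ?thesis by (simp add: linear_0[OF T])
  next
    case False
    have "(1 / norm y) *\<^sub>R y \<in> K" using False S y by (simp add: K_def subspace_mul)
    from u(2)[OF this] have "(y \<bullet> T y) / (norm y)\<^sup>2 \<le> \<mu>"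
      by (simp add: linear_scale[OF T] \<mu>_def power2_eq_square)
    then show ?thesis using False by (simp add: field_simps dot_square_norm)
  qed
  define B where "B = (\<lambda>y. \<mu> *\<^sub>R y - T y)"
  have B: "linear B" unfolding B_def by (intro linear_compose_sub T linear_scale_self)
  have Bsym: "y \<bullet> B z = B y \<bullet> z" for y z
    using sym[of y z] by (simp add: B_def inner_diff)
  have BS: "B u \<in> S" using S uS inv by (simp add: B_def subspace_diff subspace_mul)
  \<comment> \<open>\<open>B = \<mu> - T\<close> is semidefinite on \<open>S\<close> and its form
    vanishes at the maximizer \<open>u\<close>, so Cauchy-Schwarz forces
    \<open>B u = 0\<close>.\<close>
  have "(B u \<bullet> B u)\<^sup>2 \<le> (B u \<bullet> B (B u)) * (u \<bullet> B u)"
    by (rule psd_cauchy_schwarz[OF B Bsym S _ BS uS]) (use bound in \<open>simp add: B_def inner_diff\<close>)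
  also have "u \<bullet> B u = 0" by (simp add: B_def inner_diff uu \<mu>_def)
  finally have "B u = 0" by simp
  then have "T u = \<mu> *\<^sub>R u" by (simp add: B_def)
  moreover have "u \<noteq> 0" using nu by auto
  ultimately show ?thesis using that uS bound by blast
qed

text \<open>Eigenvectors of distinct eigenvalues are orthogonal, and a pairwise orthogonal set is
  finite. This makes the \<open>Max\<close> and \<open>Min\<close> in \<open>rho\<close> and
  \<open>rho2\<close> meaningful.\<close>

lemma finite_eigenvalues_symmetric:
  fixes M :: "real^'n^'n"
  assumes sym: "transpose M = M"
  shows "finite (eigenvalues M)"
proof -
  have "\<forall>l\<in>eigenvalues M. \<exists>u. u \<noteq> 0 \<and> M *v u = l *\<^sub>R u"
    by (auto simp: eigenvalues_def)
  then obtain u where u: "\<And>l. l \<in> eigenvalues M \<Longrightarrow> u l \<noteq> 0 \<and> M *v u l = l *\<^sub>R u l"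
    by metis
  have orth: "u l \<bullet> u m = 0" if lm: "l \<in> eigenvalues M" "m \<in> eigenvalues M" "l \<noteq> m" for l m
  proof -
    have "l * (u l \<bullet> u m) = (M *v u l) \<bullet> u m" using u[OF lm(1)] by simp
    also have "\<dots> = u l \<bullet> (M *v u m)" by (metis dot_lmul_matrix sym vector_transpose_matrix)
    also have "\<dots> = m * (u l \<bullet> u m)" using u[OF lm(2)] by simp
    finally show ?thesis using lm(3) by simp
  qed
  have "pairwise orthogonal (u ` eigenvalues M)"
    unfolding pairwise_def orthogonal_def using orth by blast
  then have "finite (u ` eigenvalues M)" by (rule pairwise_orthogonal_imp_finite)
  moreover have "inj_on u (eigenvalues M)"
    by (rule inj_onI) (metis inner_eq_zero_iff orth u)
  ultimately show ?thesis by (rule finite_imageD)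
qed

text \<open>This is the Kronecker product of the Laplacian with the identity of \<open>'a\<close>,
  acting on stacked vectors.\<close>

definition lap_op :: "('n::finite \<Rightarrow> 'n \<Rightarrow> real) \<Rightarrow> 'a::euclidean_space^'n \<Rightarrow> 'a^'n" where
  "lap_op a X = (\<chi> i. \<Sum>j\<in>UNIV. laplacian a $ i $ j *\<^sub>R X $ j)"

text \<open>The orthogonal complement of the consensus vectors, where the Laplacian of a connected
  graph is invertible.\<close>

definition mean_zero :: "('a::euclidean_space^'n) set" where
  "mean_zero = {X. (\<Sum>i\<in>UNIV. X $ i) = 0}"

lemma subspace_mean_zero: "subspace mean_zero"
  by (simp add: subspace_def mean_zero_def sum.distrib flip: scaleR_sum_right)

lemma linear_lap_op: "linear (lap_op a)"
  by (rule linearI)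
    (simp_all add: lap_op_def vec_eq_iff scaleR_add_right sum.distrib scaleR_sum_right mult.commute)

lemma lap_op_nth: "lap_op a X $ i = (\<Sum>j\<in>UNIV. a i j *\<^sub>R (X $ i - X $ j))"
proof -
  have "lap_op a X $ i = (\<Sum>j\<in>UNIV. (if i = j then (\<Sum>k\<in>UNIV. a i k) *\<^sub>R X $ j else 0) - a i j *\<^sub>R X $ j)"
    unfolding lap_op_def laplacian_def by (simp add: scaleR_diff_left if_distrib[of "\<lambda>c. c *\<^sub>R _"] cong: if_cong)
  also have "\<dots> = (\<Sum>k\<in>UNIV. a i k) *\<^sub>R X $ i - (\<Sum>j\<in>UNIV. a i j *\<^sub>R X $ j)"
    by (simp add: sum_subtractf)
  finally show ?thesis by (simp add: scaleR_diff_right sum_subtractf scaleR_sum_left)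
qed

context
  fixes a :: "'n::finite \<Rightarrow> 'n \<Rightarrow> real"
  assumes a_sym: "\<And>i j. a i j = a j i"
begin

lemma laplacian_symmetric: "transpose (laplacian a) = laplacian a"
  using a_sym by (auto simp: transpose_def laplacian_def vec_eq_iff)

text \<open>Average the double sum with its copy in which \<open>i\<close> and \<open>j\<close> are
  exchanged. Symmetry, semidefiniteness and the kernel are all read off this form.\<close>

lemma lap_op_inner:
  "X \<bullet> lap_op a Y = (1/2) * (\<Sum>i\<in>UNIV. \<Sum>j\<in>UNIV. a i j * ((X $ i - X $ j) \<bullet> (Y $ i - Y $ j)))"
proof -
  have 1: "X \<bullet> lap_op a Y = (\<Sum>i\<in>UNIV. \<Sum>j\<in>UNIV. a i j * (X $ i \<bullet> (Y $ i - Y $ j)))"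
    by (simp add: inner_vec_def lap_op_nth inner_sum_right)
  also have "\<dots> = (\<Sum>i\<in>UNIV. \<Sum>j\<in>UNIV. a i j * (X $ j \<bullet> (Y $ j - Y $ i)))"
    by (subst sum.swap) (simp add: a_sym)
  finally have 2: "X \<bullet> lap_op a Y = (\<Sum>i\<in>UNIV. \<Sum>j\<in>UNIV. a i j * (X $ j \<bullet> (Y $ j - Y $ i)))" .
  have "2 * (X \<bullet> lap_op a Y) = (\<Sum>i\<in>UNIV. \<Sum>j\<in>UNIV. a i j * (X $ i \<bullet> (Y $ i - Y $ j)))
      + (\<Sum>i\<in>UNIV. \<Sum>j\<in>UNIV. a i j * (X $ j \<bullet> (Y $ j - Y $ i)))"
    using 1 2 by simp
  also have "\<dots> = (\<Sum>i\<in>UNIV. \<Sum>j\<in>UNIV. a i j * ((X $ i - X $ j) \<bullet> (Y $ i - Y $ j)))"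
    unfolding sum.distrib[symmetric] by (intro sum.cong refl) (simp add: inner_diff algebra_simps)
  finally show ?thesis by simp
qed

lemma lap_op_selfadjoint: "X \<bullet> lap_op a Y = lap_op a X \<bullet> Y"
  unfolding inner_commute[of "lap_op a X"] by (simp add: lap_op_inner inner_commute)

lemma sum_lap_op: "(\<Sum>i\<in>UNIV. lap_op a X $ i) = 0"
proof -
  have "(\<Sum>i\<in>UNIV. lap_op a X $ i) = (\<Sum>i\<in>UNIV. \<Sum>j\<in>UNIV. a i j *\<^sub>R X $ i) - (\<Sum>i\<in>UNIV. \<Sum>j\<in>UNIV. a i j *\<^sub>R X $ j)"
    by (simp add: lap_op_nth scaleR_diff_right sum_subtractf)
  also have "(\<Sum>i\<in>UNIV. \<Sum>j\<in>UNIV. a i j *\<^sub>R X $ j) = (\<Sum>i\<in>UNIV. \<Sum>j\<in>UNIV. a i j *\<^sub>R X $ i)"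
    by (subst sum.swap) (simp add: a_sym)
  finally show ?thesis by simp
qed

text \<open>Pairing all blocks with one vector \<open>b\<close> maps an eigenvector of
  \<open>lap_op\<close> to one of the matrix; \<open>b\<close> is chosen so that it stays nonzero.
  Thus extremal eigenvalues of \<open>lap_op\<close> can be compared with \<open>rho\<close> and
  \<open>rho2\<close>.\<close>

lemma eigenvalue_lap_op:
  assumes "lap_op a X = l *\<^sub>R X" "X \<noteq> 0"
  shows "l \<in> eigenvalues (laplacian a)"
proof -
  obtain i where "X $ i \<noteq> 0" using assms(2) by (auto simp: vec_eq_iff)
  then obtain b where b: "X $ i \<bullet> b \<noteq> 0" using euclidean_all_zero_iff by blast
  define u where "u = (\<chi> i. X $ i \<bullet> b)"
  have "u $ i \<noteq> 0" using b by (simp add: u_def)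
  then have "u \<noteq> 0" by auto
  moreover have "laplacian a *v u = l *\<^sub>R u"
  proof -
    have "(laplacian a *v u) $ j = (lap_op a X $ j) \<bullet> b" for j
      by (simp add: matrix_vector_mult_def u_def lap_op_def inner_sum_left)
    then show ?thesis by (simp add: vec_eq_iff assms(1)) (simp add: u_def)
  qed
  ultimately show ?thesis by (auto simp: eigenvalues_def)
qed

end

context
  fixes a :: "'n::finite \<Rightarrow> 'n \<Rightarrow> real"
  assumes a_sym: "\<And>i j. a i j = a j i" and a_nonneg: "\<And>i j. 0 \<le> a i j"
begin

lemma lap_op_psd: "0 \<le> X \<bullet> lap_op a X"
  unfolding lap_op_inner[of a, OF a_sym] by (intro mult_nonneg_nonneg sum_nonneg a_nonneg) simp_all

text \<open>The top eigenvalue of \<open>lap_op\<close> is an eigenvalue of the matrix, hence at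
  most \<open>rho\<close>. The second bound is Cauchy-Schwarz for \<open>lap_op a X\<close> against
  \<open>X\<close>, followed by cancelling one factor.\<close>

lemma lap_op_le_rho:
  fixes X :: "'a::euclidean_space^'n"
  shows "X \<bullet> lap_op a X \<le> rho (laplacian a) * (X \<bullet> X)"
    and "lap_op a X \<bullet> lap_op a X \<le> (rho (laplacian a))\<^sup>2 * (X \<bullet> X)"
proof -
  let ?r = "rho (laplacian a)"
  note sa = lap_op_selfadjoint[of a, OF a_sym]
  have nonzero: "\<exists>y\<in>UNIV. (y :: 'a^'n) \<noteq> 0"
    using nonzero_Basis[OF SOME_Basis] by blast
  obtain u :: "'a^'n" and l where u: "u \<noteq> 0" "lap_op a u = l *\<^sub>R u" and l: "\<And>Y :: 'a^'n. Y \<bullet> lap_op a Y \<le> l * (Y \<bullet> Y)"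
    by (rule exists_max_eigenvector[OF linear_lap_op sa subspace_UNIV UNIV_I nonzero]) blast
  have "l \<le> ?r" unfolding rho_def
    by (intro Max_ge finite_eigenvalues_symmetric laplacian_symmetric a_sym eigenvalue_lap_op[of a, OF a_sym u(2) u(1)])
  then have le: "Y \<bullet> lap_op a Y \<le> ?r * (Y \<bullet> Y)" for Y :: "'a^'n"
    using l[of Y] by (meson inner_ge_zero mult_right_mono order_trans)
  show "X \<bullet> lap_op a X \<le> ?r * (X \<bullet> X)" by (rule le)
  let ?Y = "lap_op a X"
  have r0: "0 \<le> ?r" using le[of u] lap_op_psd[of u] u(1)
    by (metis inner_gt_zero_iff order_trans zero_le_mult_iff not_le)
  have "(?Y \<bullet> ?Y)\<^sup>2 \<le> (?Y \<bullet> lap_op a ?Y) * (X \<bullet> lap_op a X)"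
    by (rule psd_cauchy_schwarz[OF linear_lap_op sa subspace_UNIV lap_op_psd]) auto
  also have "\<dots> \<le> (?r * (?Y \<bullet> ?Y)) * (?r * (X \<bullet> X))"
    by (intro mult_mono le lap_op_psd mult_nonneg_nonneg r0 inner_ge_zero)
  finally have "(?Y \<bullet> ?Y) * (?Y \<bullet> ?Y) \<le> (?r\<^sup>2 * (X \<bullet> X)) * (?Y \<bullet> ?Y)"
    by (simp add: power2_eq_square algebra_simps)
  then show "?Y \<bullet> ?Y \<le> ?r\<^sup>2 * (X \<bullet> X)"
    by (cases "?Y = 0") (auto simp: mult_le_cancel_right)
qed

context
  assumes conn: "graph_connected a"
begin

text \<open>A vanishing sum of nonnegative edge terms makes blocks equal across every edge, hence
  along every path; a constant vector of mean zero is 0.\<close>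

lemma lap_op_kernel:
  assumes "X \<bullet> lap_op a X = 0" and "X \<in> mean_zero"
  shows "X = 0"
proof -
  have "(\<Sum>i\<in>UNIV. \<Sum>j\<in>UNIV. a i j * ((X $ i - X $ j) \<bullet> (X $ i - X $ j))) = 0"
    using assms(1) unfolding lap_op_inner[of a, OF a_sym] by simp
  then have z: "a i j * ((X $ i - X $ j) \<bullet> (X $ i - X $ j)) = 0" for i j
    by (simp add: sum_nonneg_eq_0_iff sum_nonneg a_nonneg)
  have eq: "X $ i = X $ j" for i j
  proof -
    have "(i, j) \<in> {(u, w). a u w > 0}\<^sup>*" using conn by (simp add: graph_connected_def)
    then show ?thesis
    proof (induction rule: rtrancl_induct)
      case (step y w)
      then show ?case using z[of y w] by auto
    qed simp
  qed
  have "X $ i = 0" for i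
  proof -
    have "0 = (\<Sum>j\<in>UNIV. X $ j)" using assms(2) by (simp add: mean_zero_def)
    also have "\<dots> = (\<Sum>j\<in>(UNIV :: 'n set). X $ i)" by (intro sum.cong refl eq)
    also have "\<dots> = of_nat CARD('n) *\<^sub>R X $ i" by (simp add: sum_constant_scaleR)
    finally show ?thesis by simp
  qed
  then show ?thesis by (simp add: vec_eq_iff)
qed

text \<open>Apply the maximal eigenvector lemma to the negated operator on \<open>mean_zero\<close>;
  \<open>lap_op_kernel\<close> makes the resulting eigenvalue positive.\<close>

lemma exists_least_positive_eigenvalue:
  assumes n2: "CARD('n) \<ge> 2"
  obtains l where "l \<in> eigenvalues (laplacian a)" "0 < l"
    "\<And>X :: 'a::euclidean_space^'n. X \<in> mean_zero \<Longrightarrow> l * (X \<bullet> X) \<le> X \<bullet> lap_op a X"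
proof -
  let ?T = "\<lambda>X :: 'a^'n. - lap_op a X"
  have lin: "linear ?T" by (intro linear_compose_neg linear_lap_op)
  have sa: "y \<bullet> ?T z = ?T y \<bullet> z" for y z using lap_op_selfadjoint[of a, OF a_sym] by simp
  have inv: "?T y \<in> mean_zero" for y using sum_lap_op[of a, OF a_sym] by (simp add: mean_zero_def sum_negf)
  \<comment> \<open>Two distinct nodes are required: with a single node \<open>mean_zero\<close> is
    trivial and there is no positive eigenvalue.\<close>
  obtain i j :: 'n where ij: "i \<noteq> j"
    using n2 by (metis card_le_Suc0_iff_eq finite not_less_eq_eq numeral_2_eq_2)
  obtain b :: 'a where b: "b \<noteq> 0" using nonzero_Basis SOME_Basis by blast
  have "axis i b - axis j b \<in> mean_zero"
    by (simp add: mean_zero_def sum_subtractf axis_def)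
  moreover have "axis i b - axis j b \<noteq> 0"
    using ij b by (auto simp: vec_eq_iff axis_def)
  ultimately have nt: "\<exists>y\<in>mean_zero. (y :: 'a^'n) \<noteq> 0" by blast
  obtain u :: "'a^'n" and l where u: "u \<in> mean_zero" "u \<noteq> 0" "?T u = l *\<^sub>R u"
    and l: "\<And>y. y \<in> mean_zero \<Longrightarrow> y \<bullet> ?T y \<le> l * (y \<bullet> y)"
    by (rule exists_max_eigenvector[OF lin sa subspace_mean_zero inv nt]) blast
  have eig: "lap_op a u = (- l) *\<^sub>R u" using u(3) by (metis minus_minus scaleR_minus_left)
  have "u \<bullet> lap_op a u \<noteq> 0" using lap_op_kernel u by blast
  then have "0 < u \<bullet> lap_op a u" using lap_op_psd[of u] by simp
  then have "0 < - l * (u \<bullet> u)" using eig by simp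
  then have "- l > 0" by (rule zero_less_mult_pos2) (use u(2) in simp)
  moreover have "- l \<in> eigenvalues (laplacian a)" by (rule eigenvalue_lap_op[of a, OF a_sym eig u(2)])
  moreover have "- l * (X \<bullet> X) \<le> X \<bullet> lap_op a X" if "X \<in> mean_zero" for X :: "'a^'n"
    using l[of X] that by simp
  ultimately show ?thesis using that by blast
qed

lemma rho2_pos:
  assumes n2: "CARD('n) \<ge> 2"
  shows "0 < rho2 (laplacian a)"
proof -
  let ?S = "{l \<in> eigenvalues (laplacian a). l > 0}"
  have fin: "finite ?S" using finite_eigenvalues_symmetric[OF laplacian_symmetric[of a, OF a_sym]] by simp
  obtain l where "l \<in> ?S" using exists_least_positive_eigenvalue[where 'a = real, OF n2] by blast
  then have "rho2 (laplacian a) \<in> ?S" unfolding rho2_def using Min_in[OF fin] by blast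
  then show ?thesis by simp
qed

lemma rho2_le_lap_op:
  fixes X :: "'a::euclidean_space^'n"
  assumes n2: "CARD('n) \<ge> 2" and X: "X \<in> mean_zero"
  shows "rho2 (laplacian a) * (X \<bullet> X) \<le> X \<bullet> lap_op a X"
proof -
  obtain l where l: "l \<in> eigenvalues (laplacian a)" "0 < l"
    "\<And>X :: 'a^'n. X \<in> mean_zero \<Longrightarrow> l * (X \<bullet> X) \<le> X \<bullet> lap_op a X"
    using exists_least_positive_eigenvalue[where 'a = 'a, OF n2] by blast
  have "rho2 (laplacian a) \<le> l" unfolding rho2_def
    using l finite_eigenvalues_symmetric[OF laplacian_symmetric[of a, OF a_sym]] by (intro Min_le) simp_all
  then have "rho2 (laplacian a) * (X \<bullet> X) \<le> l * (X \<bullet> X)" by (simp add: mult_right_mono)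
  then show ?thesis using l(3)[OF X] by simp
qed

text \<open>Adding the block sum to every component leaves the operator unchanged on
  \<open>mean_zero\<close> and removes its kernel. An injective linear map in finite dimension has a
  linear inverse, which serves as \<open>Q\<close>.\<close>

lemma lap_op_inverse:
  obtains Q :: "'a::euclidean_space^'n \<Rightarrow> 'a^'n"
  where "linear Q" "\<And>Y. Y \<in> mean_zero \<Longrightarrow> Q Y \<in> mean_zero"
    "\<And>Y. Y \<in> mean_zero \<Longrightarrow> lap_op a (Q Y) = Y" "\<And>X. X \<in> mean_zero \<Longrightarrow> Q (lap_op a X) = X"
proof -
  define T :: "'a^'n \<Rightarrow> 'a^'n" where "T X = lap_op a X + (\<chi> i. \<Sum>j\<in>UNIV. X $ j)" for X
  have sumT: "(\<Sum>i\<in>UNIV. T X $ i) = of_nat CARD('n) *\<^sub>R (\<Sum>j\<in>UNIV. X $ j)" for X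
    using sum_lap_op[of a, OF a_sym] by (simp add: T_def sum.distrib sum_constant_scaleR)
  \<comment> \<open>Summing the blocks kills the Laplacian part, so \<open>T\<close> reflects mean
    zero.\<close>
  have TS: "X \<in> mean_zero" if "T X \<in> mean_zero" for X
    using that sumT[of X] by (simp add: mean_zero_def)
  have TL: "T X = lap_op a X" if "X \<in> mean_zero" for X
    using that by (simp add: T_def mean_zero_def vec_eq_iff)
  have "linear T"
    by (rule linearI) (simp_all add: T_def linear_add[OF linear_lap_op] linear_scale[OF linear_lap_op]
        vec_eq_iff sum.distrib scaleR_sum_right algebra_simps)
  moreover have "inj T"
    unfolding linear_injective_0[OF \<open>linear T\<close>]
  proof (intro allI impI)
    fix X assume 0: "T X = 0"
    then have "X \<in> mean_zero" using TS[of X] by (simp add: subspace_0[OF subspace_mean_zero])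
    then show "X = 0" using 0 TL by (intro lap_op_kernel) simp_all
  qed
  ultimately obtain Q where Q: "linear Q" "\<And>Y. T (Q Y) = Y"
    by (metis linear_injective_imp_surjective linear_surjective_right_inverse comp_apply id_apply)
  have QS: "Q Y \<in> mean_zero" if "Y \<in> mean_zero" for Y using TS[of "Q Y"] Q(2) that by simp
  have QT: "Q (T X) = X" for X by (metis Q(2) \<open>inj T\<close> injD)
  show ?thesis
    by (rule that[OF Q(1) QS]) (use QS TL Q(2) QT in metis)+
qed

end
end

subsection \<open>Smoothness and quadratic growth\<close>

text \<open>\<open>\<phi>\<close> is the error of the quadratic model along the segment; the
  Lipschitz bound makes its derivative nonpositive.\<close>

lemma lipschitz_gradient_upper_bound:
  fixes f :: "'a::real_inner \<Rightarrow> real"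
  assumes grad: "\<And>y. (f has_derivative (\<lambda>h. g y \<bullet> h)) (at y)"
    and lip: "\<And>y z. norm (g y - g z) \<le> K * norm (y - z)"
  shows "f y \<le> f x + g x \<bullet> (y - x) + K / 2 * (norm (y - x))\<^sup>2"
proof -
  define h where "h = y - x"
  define \<phi> where "\<phi> s = f (x + s *\<^sub>R h) - s * (g x \<bullet> h) - K / 2 * s\<^sup>2 * (norm h)\<^sup>2" for s
  have "\<phi> 1 \<le> \<phi> 0"
  proof (rule DERIV_nonpos_imp_nonincreasing[where f = \<phi>])
    fix s :: real assume s: "0 \<le> s" "s \<le> 1"
    let ?D = "g (x + s *\<^sub>R h) \<bullet> h - g x \<bullet> h - K * s * (norm h)\<^sup>2"
    have "((\<lambda>s. f (x + s *\<^sub>R h)) has_derivative (\<lambda>t. g (x + s *\<^sub>R h) \<bullet> (t *\<^sub>R h))) (at s)"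
      by (rule has_derivative_compose[OF _ grad]) (auto intro!: derivative_eq_intros)
    then have "((\<lambda>s. f (x + s *\<^sub>R h)) has_real_derivative g (x + s *\<^sub>R h) \<bullet> h) (at s)"
      by (simp add: has_field_derivative_def mult_commute_abs)
    then have "(\<phi> has_real_derivative ?D) (at s)"
      unfolding \<phi>_def by (auto intro!: derivative_eq_intros)
    moreover have "?D \<le> 0"
    proof -
      have "g (x + s *\<^sub>R h) \<bullet> h - g x \<bullet> h \<le> norm (g (x + s *\<^sub>R h) - g x) * norm h"
        by (metis inner_diff_left norm_cauchy_schwarz)
      also have "\<dots> \<le> (K * norm ((x + s *\<^sub>R h) - x)) * norm h"
        by (intro mult_right_mono lip) simp
      finally show ?thesis using s by (simp add: power2_eq_square mult_ac)
    qed
    ultimately show "\<exists>D. (\<phi> has_real_derivative D) (at s) \<and> D \<le> 0" by blast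
  qed simp
  then show ?thesis by (simp add: \<phi>_def h_def)
qed

text \<open>A minimizer of \<open>sqrt (f - m) + c * dist x\<close> with \<open>c < sqrt (\<nu> / 2)\<close> minimizes \<open>f\<close>, since away
  from the minimizers of \<open>f\<close> the slope of \<open>sqrt (f - m)\<close> is at least \<open>sqrt (\<nu> / 2)\<close>.\<close>
lemma PL_near_minimizer:
  fixes f :: "'a::euclidean_space \<Rightarrow> real"
  assumes grad: "\<And>y. (f has_derivative (\<lambda>h. g y \<bullet> h)) (at y)"
    and lower: "\<And>y. m \<le> f y"
    and PL: "\<And>y. (1 / 2) * (norm (g y))\<^sup>2 \<ge> \<nu> * (f y - m)"
    and c: "0 < c" "c < sqrt (\<nu> / 2)"
  obtains y where "f y = m" "c * norm (x - y) \<le> sqrt (f x - m)"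
proof -
  define G where "G y = sqrt (f y - m)" for y
  define h where "h y = G y + c * norm (y - x)" for y
  have contf: "continuous_on UNIV f"
    using grad by (meson continuous_at_imp_continuous_on has_derivative_continuous)
  have conth: "continuous_on B h" for B
    unfolding h_def G_def by (intro continuous_intros continuous_on_subset[OF contf]) auto
  \<comment> \<open>Outside the ball of this radius the penalty alone exceeds
    \<open>h x = G x\<close>, so a minimizer of \<open>h\<close> over the ball is global.\<close>
  define r where "r = G x / c"
  have G0: "0 \<le> G y" for y using lower[of y] by (simp add: G_def)
  have "r \<ge> 0" using G0 c by (simp add: r_def)
  then obtain y where y: "y \<in> cball x r" "\<And>z. z \<in> cball x r \<Longrightarrow> h y \<le> h z"
    using continuous_attains_inf[of "cball x r" h] conth by force
  have hx: "h x = G x" by (simp add: h_def)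
  have ymin: "h y \<le> h z" for z
  proof (cases "z \<in> cball x r")
    case False
    then have "G x \<le> c * norm (z - x)" using c by (simp add: r_def dist_norm norm_minus_commute field_simps)
    then have "h x \<le> h z" using G0[of z] by (simp add: hx) (simp add: h_def)
    moreover have "h y \<le> h x" using y(2)[of x] \<open>r \<ge> 0\<close> by simp
    ultimately show ?thesis by simp
  qed (rule y(2))
  have "f y = m"
  proof (rule ccontr)
    assume "f y \<noteq> m"
    then have fy: "f y - m > 0" using lower[of y] by simp
    define u where "u = g y"
    have Gy: "G y > 0" using fy by (simp add: G_def)
    have "2 * \<nu> * (G y)\<^sup>2 \<le> (norm u)\<^sup>2" using PL[of y] fy by (simp add: u_def G_def)
    moreover have "c\<^sup>2 < \<nu> / 2" using c by (metis less_imp_le real_less_rsqrt real_sqrt_less_iff real_sqrt_abs abs_of_pos)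
    then have "c\<^sup>2 * (4 * (G y)\<^sup>2) < \<nu> / 2 * (4 * (G y)\<^sup>2)"
      using Gy by (intro mult_strict_right_mono) simp_all
    ultimately have "4 * c\<^sup>2 * (G y)\<^sup>2 < (norm u)\<^sup>2" by simp
    then have "(2 * c * G y)\<^sup>2 < (norm u)\<^sup>2" by (simp add: power_mult_distrib)
    \<comment> \<open>The slope of \<open>G\<close> at \<open>y\<close> is
      \<open>norm u / (2 * G y)\<close>; this inequality says that it beats the penalty rate
      \<open>c\<close>.\<close>
    then have big: "2 * c * G y < norm u" by (rule power2_less_imp_less) simp
    \<comment> \<open>Up to the constant \<open>c * norm (y - x)\<close>, \<open>\<psi>\<close>
      bounds \<open>h\<close> from above along the steepest descent ray from \<open>y\<close>, by
      the triangle inequality. Its negative derivative at 0 contradicts the minimality of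
      \<open>y\<close>.\<close>
    define \<psi> where "\<psi> s = sqrt (f (y + s *\<^sub>R (- u)) - m) + c * s * norm u" for s
    have "((\<lambda>s. f (y + s *\<^sub>R (- u))) has_derivative (\<lambda>t. g (y + 0 *\<^sub>R (- u)) \<bullet> (t *\<^sub>R (- u)))) (at 0)"
      by (rule has_derivative_compose[OF _ grad]) (auto intro!: derivative_eq_intros)
    then have "((\<lambda>s. f (y + s *\<^sub>R (- u))) has_real_derivative - (norm u)\<^sup>2) (at 0)"
      unfolding has_field_derivative_def
      by (rule has_derivative_eq_rhs) (auto simp: u_def fun_eq_iff dot_square_norm)
    then have "((\<lambda>s. f (y + s *\<^sub>R (- u)) - m) has_real_derivative - (norm u)\<^sup>2 - 0) (at 0)"
      by (intro DERIV_diff DERIV_const)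
    then have 1: "((\<lambda>s. sqrt (f (y + s *\<^sub>R (- u)) - m)) has_real_derivative
        inverse (sqrt (f y - m)) / 2 * (- (norm u)\<^sup>2 - 0)) (at 0)"
      by (rule DERIV_chain2[where f = sqrt, rotated]) (use DERIV_real_sqrt[OF fy] in simp)
    have 2: "((\<lambda>s. c * s * norm u) has_real_derivative c * norm u) (at 0)"
      by (auto intro!: derivative_eq_intros)
    have "(\<psi> has_real_derivative
        inverse (sqrt (f y - m)) / 2 * (- (norm u)\<^sup>2 - 0) + c * norm u) (at 0)"
      unfolding \<psi>_def by (rule DERIV_add[OF 1 2])
    then have "(\<psi> has_real_derivative - (norm u)\<^sup>2 * (inverse (G y) / 2) + c * norm u) (at 0)"
      by (simp add: G_def mult.commute)
    moreover have "- (norm u)\<^sup>2 * (inverse (G y) / 2) + c * norm u < 0"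
    proof -
      have "0 < 2 * c * G y" using Gy c by simp
      then have "0 < norm u" using big by linarith
      from mult_strict_right_mono[OF big this] have "c * norm u < (norm u)\<^sup>2 / (2 * G y)"
        using Gy by (simp add: pos_less_divide_eq power2_eq_square mult_ac)
      then show ?thesis by (simp add: inverse_eq_divide)
    qed
    ultimately obtain d where d: "d > 0" "\<And>s. s > 0 \<Longrightarrow> s < d \<Longrightarrow> \<psi> (0 + s) < \<psi> 0"
      using DERIV_neg_dec_right[of \<psi>] by meson
    define s where "s = d / 2"
    define z where "z = y + s *\<^sub>R (- u)"
    have s: "s > 0" "\<psi> s < \<psi> 0" using d(1) d(2)[of s] by (auto simp: s_def)
    have "norm (z - x) \<le> norm (z - y) + norm (y - x)" by (metis add.commute diff_add_cancel add_diff_eq norm_triangle_ineq)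
    also have "norm (z - y) = s * norm u" using s by (simp add: z_def)
    finally have "c * norm (z - x) \<le> c * (s * norm u + norm (y - x))" using c by simp
    then have "h z \<le> \<psi> s + c * norm (y - x)" by (simp add: h_def \<psi>_def G_def z_def algebra_simps)
    also have "\<dots> < h y" using s by (simp add: h_def \<psi>_def G_def)
    finally show False using ymin[of z] by simp
  qed
  moreover have "c * norm (x - y) \<le> G x"
    using ymin[of x] G0[of y] by (simp add: hx) (simp add: h_def norm_minus_commute)
  ultimately show ?thesis using that by (simp add: G_def)
qed

text \<open>\<open>PL_near_minimizer\<close> yields the estimate for each \<open>c\<close> strictly
  below \<open>sqrt (\<nu> / 2)\<close>, since \<open>p\<close> is no farther from \<open>x\<close>
  than any minimizer; let \<open>c\<close> tend to that bound.\<close>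

lemma PL_quadratic_growth:
  fixes f :: "'a::euclidean_space \<Rightarrow> real"
  assumes grad: "\<And>y. (f has_derivative (\<lambda>h. g y \<bullet> h)) (at y)"
    and lower: "\<And>y. m \<le> f y"
    and PL: "\<And>y. (1 / 2) * (norm (g y))\<^sup>2 \<ge> \<nu> * (f y - m)"
    and \<nu>: "0 < \<nu>"
    and p: "\<And>z. f z = m \<Longrightarrow> (norm (x - p))\<^sup>2 \<le> (norm (x - z))\<^sup>2"
  shows "\<nu> / 2 * (norm (x - p))\<^sup>2 \<le> f x - m"
proof -
  have le: "c * norm (x - p) \<le> sqrt (f x - m)" if c: "0 < c" "c < sqrt (\<nu> / 2)" for c
  proof -
    obtain y where y: "f y = m" "c * norm (x - y) \<le> sqrt (f x - m)"
      using PL_near_minimizer[OF grad lower PL c] by blast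
    have "norm (x - p) \<le> norm (x - y)" using p[OF y(1)] by (rule power2_le_imp_le) simp
    then show ?thesis using y(2) c by (meson less_imp_le mult_left_mono order_trans)
  qed
  have "sqrt (\<nu> / 2) * norm (x - p) \<le> sqrt (f x - m)"
  proof (rule tendsto_upperbound)
    show "((\<lambda>c. c * norm (x - p)) \<longlongrightarrow> sqrt (\<nu> / 2) * norm (x - p)) (at_left (sqrt (\<nu> / 2)))"
      by (intro tendsto_intros)
    show "\<forall>\<^sub>F c in at_left (sqrt (\<nu> / 2)). c * norm (x - p) \<le> sqrt (f x - m)"
      using eventually_at_left_real[of 0 "sqrt (\<nu> / 2)"] \<nu> by (auto elim!: eventually_mono intro!: le)
  qed simp
  then have "(sqrt (\<nu> / 2) * norm (x - p))\<^sup>2 \<le> (sqrt (f x - m))\<^sup>2"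
    using \<nu> by (intro power_mono) auto
  then show ?thesis using \<nu> lower[of x] by (simp add: power_mult_distrib)
qed

subsection \<open>The Lyapunov function\<close>

lemma young:
  fixes u w :: "'e::real_inner"
  assumes "0 < s"
  shows "u \<bullet> w \<le> s / 2 * (u \<bullet> u) + 1 / (2 * s) * (w \<bullet> w)"
    and "- (u \<bullet> w) \<le> s / 2 * (u \<bullet> u) + 1 / (2 * s) * (w \<bullet> w)"
proof -
  have "0 \<le> (s *\<^sub>R u - w) \<bullet> (s *\<^sub>R u - w)" "0 \<le> (s *\<^sub>R u + w) \<bullet> (s *\<^sub>R u + w)" by simp_all
  then have "2 * s * (u \<bullet> w) \<le> s\<^sup>2 * (u \<bullet> u) + w \<bullet> w" "- (2 * s * (u \<bullet> w)) \<le> s\<^sup>2 * (u \<bullet> u) + w \<bullet> w"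
    by (simp_all add: inner_add inner_diff inner_commute power2_eq_square algebra_simps)
  then show "u \<bullet> w \<le> s / 2 * (u \<bullet> u) + 1 / (2 * s) * (w \<bullet> w)"
    "- (u \<bullet> w) \<le> s / 2 * (u \<bullet> u) + 1 / (2 * s) * (w \<bullet> w)"
    using assms by (simp_all add: field_simps power2_eq_square)
qed

text \<open>\<open>Z\<close> stands for \<open>Q W\<close>. As a free argument it lets the step
  lemmas use \<open>Q\<close> only through a few inner product relations.\<close>

definition lyap :: "real \<Rightarrow> 'e::real_inner \<Rightarrow> 'e \<Rightarrow> 'e \<Rightarrow> real" where
  "lyap t X W Z = (X \<bullet> X) / 2 + (W \<bullet> Z) / 2 + t / 2 * (W \<bullet> W) + X \<bullet> W"

text \<open>Here \<open>Y\<close> is the Laplacian of \<open>X\<close> and \<open>E\<close> is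
  \<open>Q e\<close>. To first order in \<open>\<eta>\<close> the \<open>X \<bullet> W\<close> terms
  cancel through \<open>Y \<bullet> Z = X \<bullet> W\<close>, and the \<open>W \<bullet> Y\<close>
  terms through the weight \<open>\<alpha> / \<beta>\<close>.\<close>

lemma lyap_step_identity:
  fixes X Y W Z d e E :: "'e::real_inner" and \<alpha> \<beta> \<eta> :: real
  assumes "\<beta> > 0" and sa: "Y \<bullet> Z = X \<bullet> W" "e \<bullet> Z = W \<bullet> E" "Y \<bullet> E = X \<bullet> e"
  shows "lyap (\<alpha> / \<beta>) (X - \<eta> *\<^sub>R (\<alpha> *\<^sub>R Y + \<beta> *\<^sub>R W + d)) (W + (\<eta> * \<beta>) *\<^sub>R Y + (1 / \<beta>) *\<^sub>R e)
           (Z + (\<eta> * \<beta>) *\<^sub>R X + (1 / \<beta>) *\<^sub>R E)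
       = lyap (\<alpha> / \<beta>) X W Z
         - \<eta> * (\<alpha> - \<beta>) * (X \<bullet> Y) - \<eta> * \<beta> * (W \<bullet> W) - \<eta> * (X \<bullet> d) - \<eta> * (W \<bullet> d)
         + (1 / \<beta>) * (X \<bullet> e) + (1 / \<beta>) * (W \<bullet> E) + (\<alpha> / \<beta>\<^sup>2) * (W \<bullet> e)
         + \<eta>\<^sup>2 * (\<beta>\<^sup>2 / 2 * (X \<bullet> Y) + (\<alpha>\<^sup>2 - \<alpha> * \<beta>) / 2 * (Y \<bullet> Y) + \<beta>\<^sup>2 / 2 * (W \<bullet> W) + (d \<bullet> d) / 2
                 + \<beta> * (\<alpha> - \<beta>) * (W \<bullet> Y) + (\<alpha> - \<beta>) * (Y \<bullet> d) + \<beta> * (W \<bullet> d))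
         + \<eta> * (X \<bullet> e) - \<eta> * (W \<bullet> e) - (\<eta> / \<beta>) * (d \<bullet> e)
         + (1 / (2 * \<beta>\<^sup>2)) * (e \<bullet> E + \<alpha> / \<beta> * (e \<bullet> e))"
proof -
  have c: "Y \<bullet> X = X \<bullet> Y" "W \<bullet> X = X \<bullet> W" "d \<bullet> X = X \<bullet> d" "e \<bullet> X = X \<bullet> e"
    "Y \<bullet> W = W \<bullet> Y" "d \<bullet> W = W \<bullet> d" "e \<bullet> W = W \<bullet> e" "d \<bullet> Y = Y \<bullet> d" "e \<bullet> Y = Y \<bullet> e" "e \<bullet> d = d \<bullet> e"
    by (simp_all add: inner_commute)
  show ?thesis
    unfolding lyap_def using assms(1)
    by (simp add: inner_add inner_diff c sa) (simp add: field_simps power2_eq_square)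
qed

text \<open>Each remaining cross term is split by Young's inequality, with weights chosen so that
  the shares add up to the prescribed coefficients.\<close>

lemma lyap_step_bound:
  fixes X Y W Z d e E :: "'e::real_inner" and \<alpha> \<beta> \<eta> r r2 :: real
  assumes pos: "\<beta> > 0" "\<eta> > 0" "r2 > 0" and \<alpha>\<beta>: "\<beta> \<le> \<alpha>"
    and sa: "Y \<bullet> Z = X \<bullet> W" "e \<bullet> Z = W \<bullet> E" "Y \<bullet> E = X \<bullet> e"
    and XY: "r2 * (X \<bullet> X) \<le> X \<bullet> Y" "X \<bullet> Y \<le> r * (X \<bullet> X)" and YY: "Y \<bullet> Y \<le> r\<^sup>2 * (X \<bullet> X)"
    and eE: "e \<bullet> E \<le> (e \<bullet> e) / r2" and EE: "E \<bullet> E \<le> (e \<bullet> e) / r2\<^sup>2"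
  shows "lyap (\<alpha> / \<beta>) (X - \<eta> *\<^sub>R (\<alpha> *\<^sub>R Y + \<beta> *\<^sub>R W + d)) (W + (\<eta> * \<beta>) *\<^sub>R Y + (1 / \<beta>) *\<^sub>R e)
           (Z + (\<eta> * \<beta>) *\<^sub>R X + (1 / \<beta>) *\<^sub>R E)
       \<le> lyap (\<alpha> / \<beta>) X W Z
         - \<eta> * ((\<alpha> - \<beta>) * r2 - 1 - \<eta> * (\<beta>\<^sup>2 * r + (2 * \<alpha>\<^sup>2 + \<beta>\<^sup>2) * r\<^sup>2)) * (X \<bullet> X)
         - \<eta> * (\<beta> - 1 / 2 - \<alpha> / (2 * \<beta>\<^sup>2) - 1 / (2 * \<beta> * r2) - \<eta> * (2 * \<beta>\<^sup>2 + 1 / 2)) * (W \<bullet> W)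
         + (\<eta> + 5 / 2 * \<eta>\<^sup>2) * (d \<bullet> d)
         + ((1 / (2 * \<beta>)) * (1 / \<beta> + 1 / r2 + \<alpha> / \<beta>) / \<eta> + (1 / \<beta>\<^sup>2) * (1 + 1 / r2 + \<alpha> / \<beta>) + 1 / 2) * (e \<bullet> e)"
    (is "?V1 \<le> ?R")
proof -
  let ?xx = "X \<bullet> X" and ?ww = "W \<bullet> W" and ?dd = "d \<bullet> d" and ?ee = "e \<bullet> e" and ?yy = "Y \<bullet> Y"
  have nn: "?xx \<ge> 0" "?ww \<ge> 0" "?dd \<ge> 0" "?ee \<ge> 0" "?yy \<ge> 0" by simp_all
  have y1: "- \<eta> * (X \<bullet> d) \<le> \<eta> / 2 * ?xx + \<eta> / 2 * ?dd"
    using mult_left_mono[OF young(2)[of 1 X d], of \<eta>] pos by (simp add: algebra_simps)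
  have y2: "- \<eta> * (W \<bullet> d) \<le> \<eta> / 2 * ?ww + \<eta> / 2 * ?dd"
    using mult_left_mono[OF young(2)[of 1 W d], of \<eta>] pos by (simp add: algebra_simps)
  \<comment> \<open>In \<open>y3\<close> to \<open>y5\<close> the Young weight is proportional to
    \<open>\<eta>\<close>: later \<open>e \<bullet> e\<close> is bounded by a multiple of
    \<open>\<eta> * \<eta>\<close>, so both shares are of first order.\<close>
  have y3: "(1 / \<beta>) * (X \<bullet> e) \<le> \<eta> / 2 * ?xx + 1 / (2 * \<eta> * \<beta>\<^sup>2) * ?ee"
    using mult_left_mono[OF young(1)[of "\<eta> * \<beta>" X e], of "1 / \<beta>"] pos
    by (simp add: field_simps power2_eq_square)
  have y4: "(1 / \<beta>) * (W \<bullet> E) \<le> \<eta> / (2 * \<beta> * r2) * ?ww + 1 / (2 * \<eta> * \<beta> * r2) * ?ee"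
  proof -
    have "W \<bullet> E \<le> \<eta> / r2 / 2 * ?ww + 1 / (2 * (\<eta> / r2)) * (E \<bullet> E)"
      using pos by (intro young) simp
    also have "\<dots> \<le> \<eta> / r2 / 2 * ?ww + 1 / (2 * (\<eta> / r2)) * (?ee / r2\<^sup>2)"
      using pos EE by (intro add_left_mono mult_left_mono) simp_all
    also have "\<dots> = \<eta> / (2 * r2) * ?ww + 1 / (2 * \<eta> * r2) * ?ee"
      using pos by (simp add: power2_eq_square)
    finally have "(1 / \<beta>) * (W \<bullet> E) \<le> (1 / \<beta>) * (\<eta> / (2 * r2) * ?ww + 1 / (2 * \<eta> * r2) * ?ee)"
      using pos by (intro mult_left_mono) simp_all
    then show ?thesis by (simp add: algebra_simps)
  qed
  have y5: "(\<alpha> / \<beta>\<^sup>2) * (W \<bullet> e) \<le> \<eta> * \<alpha> / (2 * \<beta>\<^sup>2) * ?ww + \<alpha> / (2 * \<eta> * \<beta>\<^sup>2) * ?ee"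
    using mult_left_mono[OF young(1)[of \<eta> W e], of "\<alpha> / \<beta>\<^sup>2"] pos \<alpha>\<beta> by (simp add: algebra_simps)
  have y6: "\<beta> * (\<alpha> - \<beta>) * (W \<bullet> Y) \<le> \<beta>\<^sup>2 / 2 * ?ww + (\<alpha> - \<beta>)\<^sup>2 / 2 * ?yy"
    using young(1)[of 1 "\<beta> *\<^sub>R W" "(\<alpha> - \<beta>) *\<^sub>R Y"] by (simp add: power2_eq_square mult_ac)
  have y7: "(\<alpha> - \<beta>) * (Y \<bullet> d) \<le> (\<alpha> - \<beta>)\<^sup>2 / 2 * ?yy + 1 / 2 * ?dd"
    using young(1)[of 1 "(\<alpha> - \<beta>) *\<^sub>R Y" d] by (simp add: power2_eq_square mult_ac)
  have y8: "\<beta> * (W \<bullet> d) \<le> \<beta>\<^sup>2 / 2 * ?ww + 1 / 2 * ?dd"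
    using young(1)[of 1 "\<beta> *\<^sub>R W" d] by (simp add: power2_eq_square mult_ac)
  \<comment> \<open>The weight makes the share of \<open>X\<close> half of the
    \<open>\<beta>\<beta> r\<close> coefficient at second order; \<open>y14\<close> supplies the
    other half.\<close>
  have y9: "\<eta> * (X \<bullet> e) \<le> \<eta>\<^sup>2 * (\<beta>\<^sup>2 / 2 * (r * ?xx)) + 1 / (2 * \<beta>\<^sup>2 * r2) * ?ee"
  proof -
    have "X \<bullet> e \<le> \<eta> * \<beta>\<^sup>2 * r2 / 2 * ?xx + 1 / (2 * (\<eta> * \<beta>\<^sup>2 * r2)) * ?ee"
      using pos by (intro young) simp
    then have "\<eta> * (X \<bullet> e) \<le> \<eta> * (\<eta> * \<beta>\<^sup>2 * r2 / 2 * ?xx + 1 / (2 * (\<eta> * \<beta>\<^sup>2 * r2)) * ?ee)"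
      using pos by (intro mult_left_mono) simp_all
    also have "\<dots> = \<eta>\<^sup>2 * (\<beta>\<^sup>2 / 2 * (r2 * ?xx)) + 1 / (2 * \<beta>\<^sup>2 * r2) * ?ee"
      using pos by (simp add: field_simps power2_eq_square)
    also have "\<dots> \<le> \<eta>\<^sup>2 * (\<beta>\<^sup>2 / 2 * (r * ?xx)) + 1 / (2 * \<beta>\<^sup>2 * r2) * ?ee"
      using XY by (intro add_right_mono mult_left_mono) simp_all
    finally show ?thesis .
  qed
  have y10: "- \<eta> * (W \<bullet> e) \<le> \<eta>\<^sup>2 * (1 / 2 * ?ww) + 1 / 2 * ?ee"
    using young(2)[of 1 "\<eta> *\<^sub>R W" e] by (simp add: power2_eq_square mult_ac)
  have y11: "- (\<eta> / \<beta>) * (d \<bullet> e) \<le> \<eta>\<^sup>2 * (1 / 2 * ?dd) + 1 / (2 * \<beta>\<^sup>2) * ?ee"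
    using young(2)[of 1 "\<eta> *\<^sub>R d" "(1 / \<beta>) *\<^sub>R e"] by (simp add: power2_eq_square mult_ac)
  have y12: "(1 / (2 * \<beta>\<^sup>2)) * (e \<bullet> E + \<alpha> / \<beta> * ?ee) \<le> (1 / (2 * \<beta>\<^sup>2)) * (?ee / r2 + \<alpha> / \<beta> * ?ee)"
    using eE by (intro mult_left_mono add_right_mono) simp_all
  have y13: "- \<eta> * (\<alpha> - \<beta>) * (X \<bullet> Y) \<le> - \<eta> * (\<alpha> - \<beta>) * (r2 * ?xx)"
    using XY(1) pos \<alpha>\<beta> by (intro mult_left_mono_neg) simp_all
  have y14: "\<beta>\<^sup>2 / 2 * (X \<bullet> Y) \<le> \<beta>\<^sup>2 / 2 * (r * ?xx)"
    using XY(2) by (intro mult_left_mono) simp_all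
  \<comment> \<open>\<open>y6\<close> and \<open>y7\<close> each contribute half of the square of
    \<open>\<alpha> - \<beta>\<close>; the mixed term \<open>\<alpha> * \<beta>\<close> has a
    negative sign and is dropped.\<close>
  have y15: "((\<alpha>\<^sup>2 - \<alpha> * \<beta>) / 2 + (\<alpha> - \<beta>)\<^sup>2) * ?yy \<le> (2 * \<alpha>\<^sup>2 + \<beta>\<^sup>2) * (r\<^sup>2 * ?xx)"
  proof (rule mult_mono)
    have "0 \<le> \<alpha> * \<beta>" "0 \<le> \<alpha>\<^sup>2" using pos \<alpha>\<beta> by simp_all
    moreover have "(\<alpha>\<^sup>2 - \<alpha> * \<beta>) / 2 + (\<alpha> - \<beta>)\<^sup>2 = 3 / 2 * \<alpha>\<^sup>2 - 5 / 2 * (\<alpha> * \<beta>) + \<beta>\<^sup>2"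
      by (simp add: power2_diff field_simps)
    ultimately show "(\<alpha>\<^sup>2 - \<alpha> * \<beta>) / 2 + (\<alpha> - \<beta>)\<^sup>2 \<le> 2 * \<alpha>\<^sup>2 + \<beta>\<^sup>2" by linarith
  qed (use YY in simp_all)
  have y16: "\<beta>\<^sup>2 / 2 * (X \<bullet> Y) + (\<alpha>\<^sup>2 - \<alpha> * \<beta>) / 2 * ?yy + \<beta>\<^sup>2 / 2 * ?ww + ?dd / 2
                 + \<beta> * (\<alpha> - \<beta>) * (W \<bullet> Y) + (\<alpha> - \<beta>) * (Y \<bullet> d) + \<beta> * (W \<bullet> d)
       \<le> \<beta>\<^sup>2 / 2 * (r * ?xx) + (2 * \<alpha>\<^sup>2 + \<beta>\<^sup>2) * (r\<^sup>2 * ?xx) + 3 / 2 * (\<beta>\<^sup>2 * ?ww) + 3 / 2 * ?dd"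
    using y6 y7 y8 y14 y15 by (simp add: algebra_simps)
  have "?V1 \<le> lyap (\<alpha> / \<beta>) X W Z + - \<eta> * (\<alpha> - \<beta>) * (r2 * ?xx) - \<eta> * \<beta> * ?ww
      + (\<eta> / 2 * ?xx + \<eta> / 2 * ?dd) + (\<eta> / 2 * ?ww + \<eta> / 2 * ?dd)
      + (\<eta> / 2 * ?xx + 1 / (2 * \<eta> * \<beta>\<^sup>2) * ?ee)
      + (\<eta> / (2 * \<beta> * r2) * ?ww + 1 / (2 * \<eta> * \<beta> * r2) * ?ee)
      + (\<eta> * \<alpha> / (2 * \<beta>\<^sup>2) * ?ww + \<alpha> / (2 * \<eta> * \<beta>\<^sup>2) * ?ee)
      + \<eta>\<^sup>2 * (\<beta>\<^sup>2 / 2 * (r * ?xx) + (2 * \<alpha>\<^sup>2 + \<beta>\<^sup>2) * (r\<^sup>2 * ?xx) + 3 / 2 * (\<beta>\<^sup>2 * ?ww) + 3 / 2 * ?dd)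
      + (\<eta>\<^sup>2 * (\<beta>\<^sup>2 / 2 * (r * ?xx)) + 1 / (2 * \<beta>\<^sup>2 * r2) * ?ee)
      + (\<eta>\<^sup>2 * (1 / 2 * ?ww) + 1 / 2 * ?ee) + (\<eta>\<^sup>2 * (1 / 2 * ?dd) + 1 / (2 * \<beta>\<^sup>2) * ?ee)
      + (1 / (2 * \<beta>\<^sup>2)) * (?ee / r2 + \<alpha> / \<beta> * ?ee)" (is "_ \<le> ?S")
    unfolding lyap_step_identity[OF pos(1) sa]
    using y1 y2 y3 y4 y5 mult_left_mono[OF y16, of "\<eta>\<^sup>2"] y9 y10 y11 y12 y13 by simp
  \<comment> \<open>The subtracted terms are the slack of the stated coefficients.\<close>
  also have "?S = ?R - \<eta>\<^sup>2 * (\<beta>\<^sup>2 / 2 * ?ww + 1 / 2 * ?dd)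
      - (1 / (2 * \<beta>\<^sup>2) + \<alpha> / (2 * \<beta>\<^sup>2 * \<beta>)) * ?ee"
  proof -
    \<comment> \<open>Naming the reciprocals turns the identity into a polynomial one.\<close>
    define b c h where "b = 1 / \<beta>" and "c = 1 / r2" and "h = 1 / \<eta>"
    have "1 / (2 * \<eta> * \<beta>\<^sup>2) = h * b * b / 2" "\<eta> / (2 * \<beta> * r2) = \<eta> * b * c / 2"
      "1 / (2 * \<eta> * \<beta> * r2) = h * b * c / 2" "\<eta> * \<alpha> / (2 * \<beta>\<^sup>2) = \<eta> * \<alpha> * b * b / 2"
      "\<alpha> / (2 * \<eta> * \<beta>\<^sup>2) = \<alpha> * h * b * b / 2" "1 / (2 * \<beta>\<^sup>2 * r2) = b * b * c / 2"
      "1 / (2 * \<beta>\<^sup>2) = b * b / 2" "\<alpha> / (2 * \<beta>\<^sup>2) = \<alpha> * b * b / 2" "1 / (2 * \<beta> * r2) = b * c / 2"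
      "1 / (2 * \<beta>) = b / 2" "1 / \<beta> = b" "1 / r2 = c" "1 / \<beta>\<^sup>2 = b * b" "\<alpha> / \<beta> = \<alpha> * b"
      "\<alpha> / (2 * \<beta>\<^sup>2 * \<beta>) = \<alpha> * b * b * b / 2" and "\<And>y. y / \<eta> = y * h" "\<And>y. y / r2 = y * c"
      by (simp_all add: b_def c_def h_def power2_eq_square)
    note eqs = this
    show ?thesis
      unfolding eqs by (simp add: algebra_simps power2_eq_square add_divide_distrib diff_divide_distrib)
  qed
  also have "\<dots> \<le> ?R"
  proof -
    have "0 \<le> \<eta>\<^sup>2 * (\<beta>\<^sup>2 / 2 * ?ww + 1 / 2 * ?dd)"
      "0 \<le> (1 / (2 * \<beta>\<^sup>2) + \<alpha> / (2 * \<beta>\<^sup>2 * \<beta>)) * ?ee"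
      using pos \<alpha>\<beta> nn by (auto intro!: mult_nonneg_nonneg add_nonneg_nonneg)
    moreover have "u - p - q \<le> u" if "0 \<le> p" "0 \<le> q" for u p q :: real using that by simp
    ultimately show ?thesis by blast
  qed
  finally show ?thesis .
qed

text \<open>Young's inequality gives \<open>X \<bullet> X\<close> the coefficient 1 and
  \<open>W \<bullet> W\<close> the stated one, which is the larger since
  \<open>1 \<le> t\<close>.\<close>

lemma lyap_upper:
  assumes "1 \<le> t" "0 < r2" "W \<bullet> Z \<le> (W \<bullet> W) / r2"
  shows "lyap t X W Z \<le> ((t + 1) / 2 + 1 / (2 * r2)) * (X \<bullet> X + W \<bullet> W)"
proof -
  have "X \<bullet> W \<le> 1 / 2 * (X \<bullet> X) + 1 / 2 * (W \<bullet> W)" using young(1)[of 1 X W] by simp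
  moreover have "(W \<bullet> Z) / 2 \<le> 1 / (2 * r2) * (W \<bullet> W)" using assms by simp
  moreover have "1 * (X \<bullet> X) \<le> ((t + 1) / 2 + 1 / (2 * r2)) * (X \<bullet> X)"
    using assms by (intro mult_right_mono add_increasing2) simp_all
  ultimately show ?thesis by (simp add: lyap_def algebra_simps add_divide_distrib)
qed

text \<open>The Young weight \<open>1 / t\<close> makes the share of \<open>W\<close> cancel
  \<open>t / 2 * (W \<bullet> W)\<close> exactly.\<close>

lemma lyap_lower:
  assumes "0 < t" "0 \<le> W \<bullet> Z"
  shows "(1 - 1 / t) / 2 * (X \<bullet> X) \<le> lyap t X W Z"
  using young(2)[of "1 / t" X W] assms by (simp add: lyap_def algebra_simps)

text \<open>Scalar bookkeeping: \<open>G\<close>, \<open>G0\<close> and \<open>D\<close> stand for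
  \<open>n\<close> times the squared norms of the average gradient used, of the true gradient at the
  mean, and of their difference.\<close>

lemma lyap_combined_descent:
  fixes \<alpha> \<beta> \<eta> r r2 K m :: real
  defines "\<epsilon>1 \<equiv> (\<alpha> - \<beta>) * r2 - (1 / 2) * (2 + 3 * K\<^sup>2)"
    and "\<epsilon>2 \<equiv> \<beta>\<^sup>2 * r + (2 * \<alpha>\<^sup>2 + \<beta>\<^sup>2) * r\<^sup>2 + (5 / 2) * K\<^sup>2"
    and "\<epsilon>3 \<equiv> \<beta> - 1 / 2 - \<alpha> / (2 * \<beta>\<^sup>2) - 1 / (2 * \<beta> * r2)"
    and "\<epsilon>4 \<equiv> 2 * \<beta>\<^sup>2 + 1 / 2"
    and "\<epsilon>5 \<equiv> 1 / 4 - (1 / (2 * \<beta>)) * (1 / \<beta> + 1 / r2 + \<alpha> / \<beta>) * K\<^sup>2"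
    and "\<epsilon>6 \<equiv> (1 / \<beta>\<^sup>2) * (1 + 1 / r2 + \<alpha> / \<beta>) * K\<^sup>2 + K * (1 + K) / 2"
  assumes pos: "\<beta> > 0" "\<eta> > 0" "r2 > 0" "\<alpha> > 0" "K \<ge> 0" and m: "1 \<le> m" "m \<le> 2"
    and \<eta>5: "\<eta> * \<epsilon>6 \<le> \<epsilon>5"
    and U: "U' \<le> U
         - \<eta> * ((\<alpha> - \<beta>) * r2 - 1 - \<eta> * (\<beta>\<^sup>2 * r + (2 * \<alpha>\<^sup>2 + \<beta>\<^sup>2) * r\<^sup>2)) * xx
         - \<eta> * (\<beta> - 1 / 2 - \<alpha> / (2 * \<beta>\<^sup>2) - 1 / (2 * \<beta> * r2) - \<eta> * (2 * \<beta>\<^sup>2 + 1 / 2)) * ww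
         + (\<eta> + 5 / 2 * \<eta>\<^sup>2) * dd
         + ((1 / (2 * \<beta>)) * (1 / \<beta> + 1 / r2 + \<alpha> / \<beta>) / \<eta> + (1 / \<beta>\<^sup>2) * (1 + 1 / r2 + \<alpha> / \<beta>) + 1 / 2) * ee"
    and F: "F' \<le> F - \<eta> / 2 * (G + G0 - D) + K / 2 * \<eta>\<^sup>2 * G"
    and dD: "dd + D \<le> K\<^sup>2 * xx" and ee: "ee \<le> \<eta>\<^sup>2 * K\<^sup>2 * G" and G0: "2 * \<nu> * F \<le> G0"
    and nn: "0 \<le> dd" "0 \<le> D" "0 \<le> xx" "0 \<le> G"
  shows "U' + m * F' \<le> U + m * F - \<eta> * (\<epsilon>1 - \<eta> * \<epsilon>2) * xx - \<eta> * (\<epsilon>3 - \<eta> * \<epsilon>4) * ww - \<eta> * \<nu> * (m * F)"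
proof -
  define A where "A = (1 / (2 * \<beta>)) * (1 / \<beta> + 1 / r2 + \<alpha> / \<beta>)"
  define B where "B = (1 / \<beta>\<^sup>2) * (1 + 1 / r2 + \<alpha> / \<beta>)"
  have AB: "0 \<le> A" "0 \<le> B" using pos by (simp_all add: A_def B_def)
  have e56: "\<epsilon>5 = 1 / 4 - A * K\<^sup>2" "\<epsilon>6 = B * K\<^sup>2 + K / 2 + K\<^sup>2 / 2"
    by (simp_all add: \<epsilon>5_def \<epsilon>6_def A_def B_def power2_eq_square algebra_simps add_divide_distrib)
  have s: "(A / \<eta> + B + 1 / 2) * ee \<le> (A / \<eta> + B + 1 / 2) * (\<eta>\<^sup>2 * K\<^sup>2 * G)"
    using ee AB pos by (intro mult_left_mono add_nonneg_nonneg) simp_all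
  also have "\<dots> = (\<eta> * (1 / 4 - \<epsilon>5) + \<eta>\<^sup>2 * (\<epsilon>6 - K / 2)) * G"
    using pos by (simp add: e56 field_simps power2_eq_square)
  finally have 1: "(A / \<eta> + B + 1 / 2) * ee \<le> (\<eta> * (1 / 4 - \<epsilon>5) + \<eta>\<^sup>2 * (\<epsilon>6 - K / 2)) * G" .
  \<comment> \<open>Here \<open>m \<le> 2\<close> enters: the weight on \<open>\<eta> * D\<close> is
    at most 1, so the joint bound on \<open>dd + D\<close> covers both terms.\<close>
  have 2: "\<eta> * dd + m * (\<eta> / 2 * D) \<le> \<eta> * (3 / 2 * K\<^sup>2 * xx)"
  proof -
    have "m * (\<eta> / 2 * D) \<le> 2 * (\<eta> / 2 * D)" using m pos nn by (intro mult_right_mono) simp_all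
    moreover have "\<eta> * (dd + D) \<le> \<eta> * (K\<^sup>2 * xx)" using dD pos by simp
    moreover have "\<eta> * (K\<^sup>2 * xx) \<le> \<eta> * (3 / 2 * K\<^sup>2 * xx)" using pos nn by simp
    ultimately show ?thesis by (simp add: algebra_simps)
  qed
  have 3: "5 / 2 * \<eta>\<^sup>2 * dd \<le> 5 / 2 * \<eta>\<^sup>2 * (K\<^sup>2 * xx)" using dD nn by (intro mult_left_mono) simp_all
  \<comment> \<open>This collects all terms in \<open>G\<close>. The step size bound gives
    \<open>p \<le> 1 / 4\<close>, and with \<open>1 \<le> m\<close> the coefficient of
    \<open>\<eta> * G\<close> is at most \<open>- m / 4\<close>.\<close>
  have 4: "(\<eta> * (1 / 4 - \<epsilon>5) + \<eta>\<^sup>2 * (\<epsilon>6 - K / 2)) * G - m * (\<eta> / 2 * G) + m * (K / 2 * \<eta>\<^sup>2 * G) \<le> 0"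
  proof -
    have "0 \<le> A * K\<^sup>2" "0 \<le> \<eta> * (B * K\<^sup>2 + K\<^sup>2 / 2)" using AB pos by simp_all
    moreover define p where "p = \<eta> * (K / 2)"
    ultimately have "p \<le> 1 / 4" using \<eta>5 by (simp add: e56 algebra_simps)
    then have "(m - 1) * p \<le> (m - 1) * (1 / 4)" using m by (intro mult_left_mono) simp_all
    then have "m * p - p \<le> m / 4 - 1 / 4" by (simp add: algebra_simps)
    then have "1 / 4 - \<epsilon>5 + (\<eta> * \<epsilon>6 - p) - m / 2 + m * p \<le> 0" using \<eta>5 m by linarith
    then have "1 / 4 - \<epsilon>5 + \<eta> * (\<epsilon>6 - K / 2) - m / 2 + m * (K / 2 * \<eta>) \<le> 0"
      unfolding p_def by (simp only: right_diff_distrib mult.commute mult.left_commute)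
    then have "(\<eta> * G) * (1 / 4 - \<epsilon>5 + \<eta> * (\<epsilon>6 - K / 2) - m / 2 + m * (K / 2 * \<eta>)) \<le> 0"
      using pos nn by (intro mult_nonneg_nonpos) simp_all
    then show ?thesis by (simp add: algebra_simps power2_eq_square)
  qed
  have 5: "m * F' \<le> m * F - m * (\<eta> / 2 * G) - m * (\<eta> / 2 * G0) + m * (\<eta> / 2 * D) + m * (K / 2 * \<eta>\<^sup>2 * G)"
    using mult_left_mono[OF F, of m] m by (simp add: algebra_simps add_divide_distrib diff_divide_distrib)
  have 6: "m * (\<eta> / 2 * (2 * \<nu> * F)) \<le> m * (\<eta> / 2 * G0)"
    using G0 pos m by (intro mult_left_mono) simp_all
  have "U' + m * F' \<le> U
         - \<eta> * ((\<alpha> - \<beta>) * r2 - 1 - \<eta> * (\<beta>\<^sup>2 * r + (2 * \<alpha>\<^sup>2 + \<beta>\<^sup>2) * r\<^sup>2)) * xx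
         - \<eta> * (\<epsilon>3 - \<eta> * \<epsilon>4) * ww + (\<eta> * dd + 5 / 2 * \<eta>\<^sup>2 * dd) + (A / \<eta> + B + 1 / 2) * ee
         + (m * F - m * (\<eta> / 2 * G) - m * (\<eta> / 2 * G0) + m * (\<eta> / 2 * D) + m * (K / 2 * \<eta>\<^sup>2 * G))"
    using U 5 by (simp add: A_def B_def \<epsilon>3_def \<epsilon>4_def distrib_right)
  also have "\<dots> \<le> U
         - \<eta> * ((\<alpha> - \<beta>) * r2 - 1 - \<eta> * (\<beta>\<^sup>2 * r + (2 * \<alpha>\<^sup>2 + \<beta>\<^sup>2) * r\<^sup>2)) * xx
         - \<eta> * (\<epsilon>3 - \<eta> * \<epsilon>4) * ww + \<eta> * (3 / 2 * K\<^sup>2 * xx) + 5 / 2 * \<eta>\<^sup>2 * (K\<^sup>2 * xx)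
         + m * F - m * (\<eta> / 2 * (2 * \<nu> * F))"
    using 1 2 3 4 6 by linarith
  also have "\<dots> = U + m * F - \<eta> * (\<epsilon>1 - \<eta> * \<epsilon>2) * xx - \<eta> * (\<epsilon>3 - \<eta> * \<epsilon>4) * ww - \<eta> * \<nu> * (m * F)"
    by (simp add: \<epsilon>1_def \<epsilon>2_def algebra_simps power2_eq_square)
  finally show ?thesis .
qed

lemma sum_norm_sq_diff_mean:
  fixes u :: "'n::finite \<Rightarrow> 'a::real_inner"
  defines "m \<equiv> (1 / real CARD('n)) *\<^sub>R (\<Sum>i\<in>UNIV. u i)"
  shows "(\<Sum>i\<in>UNIV. (norm (u i - p))\<^sup>2) = (\<Sum>i\<in>UNIV. (norm (u i - m))\<^sup>2) + real CARD('n) * (norm (m - p))\<^sup>2"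
proof -
  have "(norm (u i - p))\<^sup>2 = (norm (u i - m))\<^sup>2 + 2 * ((u i - m) \<bullet> (m - p)) + (norm (m - p))\<^sup>2" for i
    by (simp add: power2_norm_eq_inner inner_diff inner_commute)
  then have "(\<Sum>i\<in>UNIV. (norm (u i - p))\<^sup>2) = (\<Sum>i\<in>UNIV. (norm (u i - m))\<^sup>2)
      + 2 * ((\<Sum>i\<in>UNIV. u i - m) \<bullet> (m - p)) + real CARD('n) * (norm (m - p))\<^sup>2"
    by (simp add: sum.distrib sum_distrib_left inner_sum_left)
  moreover have "(\<Sum>i\<in>UNIV. u i - m) = 0" by (simp add: m_def sum_subtractf sum_constant_scaleR)
  ultimately show ?thesis by simp
qed

subsection \<open>Linear convergence\<close>

theorem theorem2:
  fixes a :: "'n::finite \<Rightarrow> 'n \<Rightarrow> real"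
    and fi :: "'n \<Rightarrow> 'a::euclidean_space \<Rightarrow> real"
    and gfi :: "'n \<Rightarrow> 'a \<Rightarrow> 'a"
    and Lf \<nu> \<kappa>2 \<alpha> \<beta> \<eta> :: real
    and x v :: "nat \<Rightarrow> 'n \<Rightarrow> 'a"
    and L :: "real^'n^'n"
    and f :: "'a \<Rightarrow> real" and gf :: "'a \<Rightarrow> 'a"
    and Xstar :: "'a set" and fstar :: real and xbar :: "nat \<Rightarrow> 'a"
    and \<kappa>1 \<kappa>3 \<kappa>4 \<epsilon>1 \<epsilon>2 \<epsilon>3 \<epsilon>4 \<epsilon>5 \<epsilon>6 \<epsilon>8 \<epsilon>9 \<epsilon>10 \<epsilon> c V0 :: real
    and P :: "'a \<Rightarrow> 'a"
  defines "L \<equiv> laplacian a"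
    and "f \<equiv> (\<lambda>y. (1 / real CARD('n)) * (\<Sum>i\<in>UNIV. fi i y))"
    and "gf \<equiv> (\<lambda>y. (1 / real CARD('n)) *\<^sub>R (\<Sum>i\<in>UNIV. gfi i y))"
    and "Xstar \<equiv> {y. \<forall>z. f y \<le> f z}"
    and "fstar \<equiv> (INF z. f z)"
    and "xbar \<equiv> (\<lambda>k. (1 / real CARD('n)) *\<^sub>R (\<Sum>i\<in>UNIV. x k i))"
    and "\<kappa>1 \<equiv> (2 + 3 * Lf\<^sup>2) / (2 * rho2 L)"
    and "\<kappa>3 \<equiv> (1 / 4) * (1 + sqrt (1 + 8 * \<kappa>2 + 8 / rho2 L))"
    and "\<kappa>4 \<equiv> (\<kappa>2 + 1 / rho2 L) * Lf\<^sup>2 + sqrt ((\<kappa>2 + 1 / rho2 L)\<^sup>2 * Lf\<^sup>2 + 2) * Lf"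
    and "\<epsilon>1 \<equiv> (\<alpha> - \<beta>) * rho2 L - (1 / 2) * (2 + 3 * Lf\<^sup>2)"
    and "\<epsilon>2 \<equiv> \<beta>\<^sup>2 * rho L + (2 * \<alpha>\<^sup>2 + \<beta>\<^sup>2) * (rho L)\<^sup>2 + (5 / 2) * Lf\<^sup>2"
    and "\<epsilon>3 \<equiv> \<beta> - 1 / 2 - \<alpha> / (2 * \<beta>\<^sup>2) - 1 / (2 * \<beta> * rho2 L)"
    and "\<epsilon>4 \<equiv> 2 * \<beta>\<^sup>2 + 1 / 2"
    and "\<epsilon>5 \<equiv> 1 / 4 - (1 / (2 * \<beta>)) * (1 / \<beta> + 1 / rho2 L + \<alpha> / \<beta>) * Lf\<^sup>2"
    and "\<epsilon>6 \<equiv> (1 / \<beta>\<^sup>2) * (1 + 1 / rho2 L + \<alpha> / \<beta>) * Lf\<^sup>2 + Lf * (1 + Lf) / 2"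
    and "\<epsilon>8 \<equiv> (\<alpha> + \<beta>) / (2 * \<beta>) + 1 / (2 * rho2 L)"
    and "\<epsilon>9 \<equiv> min (1 / (2 * rho L)) ((\<alpha> - \<beta>) / (2 * \<alpha>))"
    and "\<epsilon>10 \<equiv> \<eta> * min (min (\<epsilon>1 - \<eta> * \<epsilon>2) (\<epsilon>3 - \<eta> * \<epsilon>4)) (\<nu> / 2)"
    and "\<epsilon> \<equiv> \<epsilon>10 / \<epsilon>8"
    and "V0 \<equiv> Knorm2 (x 0) + Knorm2 (\<lambda>i. v 0 i + (1 / \<beta>) *\<^sub>R gfi i (xbar 0))
              + real CARD('n) * (f (xbar 0) - fstar)"
    and "c \<equiv> \<epsilon>8 * V0 / \<epsilon>9"
    and "P \<equiv> (\<lambda>y. THE p. p \<in> Xstar \<and> (\<forall>z\<in>Xstar. (norm (y - p))\<^sup>2 \<le> (norm (y - z))\<^sup>2))"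
  assumes n2: "CARD('n) \<ge> 2"
    and a_sym: "\<forall>i j. a i j = a j i"
    and a_nonneg: "\<forall>i j. a i j \<ge> 0"
    and A1: "graph_connected a"
    and A2: "Xstar \<noteq> {}"
    and grad: "\<forall>i y. (fi i has_derivative (\<lambda>h. gfi i y \<bullet> h)) (at y)"
    and A3: "\<forall>i y z. norm (gfi i y - gfi i z) \<le> Lf * norm (y - z)"
    and A4: "\<nu> > 0" "\<forall>y. (1 / 2) * (norm (gf y))\<^sup>2 \<ge> \<nu> * (f y - fstar)"
    and k2: "\<kappa>2 > 1"
    and beta: "\<beta> > max (max (\<kappa>1 / (\<kappa>2 - 1)) \<kappa>3) \<kappa>4"
    and alpha: "\<beta> + \<kappa>1 < \<alpha>" "\<alpha> \<le> \<kappa>2 * \<beta>"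
    and eta: "0 < \<eta>" "\<eta> < min (min (\<epsilon>1 / \<epsilon>2) (\<epsilon>3 / \<epsilon>4)) (\<epsilon>5 / \<epsilon>6)"
    and v0: "(\<Sum>j\<in>UNIV. v 0 j) = 0"
    and xstep: "\<forall>k i. x (Suc k) i = x k i - \<eta> *\<^sub>R
                  (\<alpha> *\<^sub>R (\<Sum>j\<in>UNIV. (L $ i $ j) *\<^sub>R x k j) + \<beta> *\<^sub>R v k i + gfi i (x k i))"
    and vstep: "\<forall>k i. v (Suc k) i = v k i + (\<eta> * \<beta>) *\<^sub>R (\<Sum>j\<in>UNIV. (L $ i $ j) *\<^sub>R x k j)"
  shows "(\<forall>k. (\<Sum>i\<in>UNIV. (norm (x k i - xbar k))\<^sup>2) + real CARD('n) * (f (xbar k) - fstar)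
                \<le> (1 - \<epsilon>) ^ k * c)
       \<and> ((\<forall>y. \<exists>!p. p \<in> Xstar \<and> (\<forall>z\<in>Xstar. (norm (y - p))\<^sup>2 \<le> (norm (y - z))\<^sup>2)) \<longrightarrow>
          (\<forall>k. (\<Sum>i\<in>UNIV. (norm (x k i - P (xbar k)))\<^sup>2) \<le> (1 - \<epsilon>) ^ k * c * (1 + 1 / (2 * \<nu>))))"
proof -

  \<comment> \<open>Signs of the constants\<close>
  define n where "n = real CARD('n)"
  have n: "n > 0" by (simp add: n_def)
  have sym: "\<And>i j. a i j = a j i" and a0: "\<And>i j. 0 \<le> a i j" using a_sym a_nonneg by blast+
  define r2 r where "r2 = rho2 L" and "r = rho L"
  have r2: "0 < r2" unfolding r2_def L_def by (rule rho2_pos[of a, OF sym a0 A1 n2])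
  \<comment> \<open>The Lipschitz bound at a nonzero vector forces the sign of
    \<open>Lf\<close>.\<close>
  have Lf0: "0 \<le> Lf"
  proof -
    obtain b :: 'a where b: "b \<noteq> 0" using nonzero_Basis SOME_Basis by blast
    have "0 \<le> Lf * norm (b - 0)"
      using A3[rule_format, of undefined b 0] norm_ge_zero order_trans by blast
    then show ?thesis using b by (simp add: zero_le_mult_iff)
  qed
  have \<kappa>1: "0 < \<kappa>1" unfolding \<kappa>1_def using r2 by (auto simp: r2_def intro!: divide_pos_pos add_pos_nonneg)
  have \<beta>: "0 < \<beta>"
  proof -
    have "0 \<le> sqrt (1 + 8 * \<kappa>2 + 8 / rho2 L)" using k2 r2 by (simp add: r2_def)
    then have "0 < \<kappa>3" unfolding \<kappa>3_def by (intro mult_pos_pos add_pos_nonneg) (assumption | simp)+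
    then show ?thesis using beta by simp
  qed
  have \<alpha>\<beta>: "\<beta> < \<alpha>" using alpha \<kappa>1 by simp
  then have \<alpha>: "0 < \<alpha>" using \<beta> by simp
  \<comment> \<open>Testing both spectral bounds on one nonzero mean-zero vector compares
    \<open>r2\<close> with \<open>r\<close>.\<close>
  obtain ev :: "real^'n" where ev: "r * (ev \<bullet> ev) \<ge> r2 * (ev \<bullet> ev)" "ev \<noteq> 0"
  proof -
    obtain i j :: 'n where ij: "i \<noteq> j"
      using n2 by (metis card_le_Suc0_iff_eq finite not_less_eq_eq numeral_2_eq_2)
    let ?u = "axis i 1 - axis j 1 :: real^'n"
    have "?u \<in> mean_zero" by (simp add: mean_zero_def sum_subtractf axis_def)
    then have "r2 * (?u \<bullet> ?u) \<le> r * (?u \<bullet> ?u)"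
      unfolding r2_def r_def L_def
      using rho2_le_lap_op[of a, OF sym a0 A1 n2] lap_op_le_rho(1)[of a, OF sym a0] order_trans by blast
    moreover have "?u \<noteq> 0" using ij by (auto simp: vec_eq_iff axis_def)
    ultimately show ?thesis using that by blast
  qed
  then have r: "r2 \<le> r" by simp
  then have r0: "0 < r" using r2 by simp

  \<comment> \<open>Step size, contraction rate and weights\<close>
  have \<epsilon>2: "0 < \<epsilon>2" unfolding \<epsilon>2_def using \<beta> r0 by (auto simp: r_def intro!: add_pos_nonneg mult_nonneg_nonneg)
  have \<epsilon>4: "0 < \<epsilon>4" unfolding \<epsilon>4_def by (simp add: add_nonneg_pos)
  have \<epsilon>6: "0 \<le> \<epsilon>6" unfolding \<epsilon>6_def using \<beta> r2 \<alpha> Lf0 by (simp add: r2_def)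
  have \<eta>\<epsilon>: "\<eta> < \<epsilon>1 / \<epsilon>2" "\<eta> < \<epsilon>3 / \<epsilon>4" "\<eta> < \<epsilon>5 / \<epsilon>6" using eta(2) by simp_all
  have d1: "0 < \<epsilon>1 - \<eta> * \<epsilon>2" using \<eta>\<epsilon>(1) \<epsilon>2 by (simp add: pos_less_divide_eq)
  have d3: "0 < \<epsilon>3 - \<eta> * \<epsilon>4" using \<eta>\<epsilon>(2) \<epsilon>4 by (simp add: pos_less_divide_eq)
  have d5: "\<eta> * \<epsilon>6 \<le> \<epsilon>5"
  proof -
    \<comment> \<open>Division by zero yields 0, so \<open>\<epsilon>6 = 0\<close> would bound
      \<open>\<eta>\<close> above by 0.\<close>
    have "\<epsilon>6 \<noteq> 0" using \<eta>\<epsilon>(3) eta(1) by auto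
    then show ?thesis using \<eta>\<epsilon>(3) \<epsilon>6 by (simp add: pos_less_divide_eq)
  qed
  have \<epsilon>10: "0 < \<epsilon>10" unfolding \<epsilon>10_def using eta(1) d1 d3 A4(1) by simp
  have \<epsilon>10_le: "\<epsilon>10 \<le> \<eta> * (\<epsilon>1 - \<eta> * \<epsilon>2)" "\<epsilon>10 \<le> \<eta> * (\<epsilon>3 - \<eta> * \<epsilon>4)" "\<epsilon>10 \<le> \<eta> * (\<nu> / 2)"
    unfolding \<epsilon>10_def
    by (rule mult_left_mono, meson min.cobounded1 min.cobounded2 order_trans, use eta(1) in simp)+
  define t where "t = \<alpha> / \<beta>"
  have t: "1 < t" using \<alpha>\<beta> \<beta> by (simp add: t_def)
  have \<epsilon>8_eq: "\<epsilon>8 = (t + 1) / 2 + 1 / (2 * r2)"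
    using \<beta> by (simp add: \<epsilon>8_def t_def r2_def field_simps)
  have \<epsilon>8: "(t + 1) / 2 < \<epsilon>8" using r2 by (simp add: \<epsilon>8_eq)
  then have \<epsilon>8_1: "1 \<le> \<epsilon>8" using t by simp
  have \<epsilon>9_le: "\<epsilon>9 \<le> (1 - 1 / t) / 2"
  proof -
    have "(\<alpha> - \<beta>) / (2 * \<alpha>) = (1 - 1 / t) / 2" using \<alpha> \<beta> by (simp add: t_def field_simps)
    from this[symmetric] show ?thesis unfolding \<epsilon>9_def by (simp only: min.cobounded2)
  qed
  have \<epsilon>9: "0 < \<epsilon>9" unfolding \<epsilon>9_def using r0 \<alpha> \<alpha>\<beta> by (simp add: r_def)
  have \<epsilon>9_half: "\<epsilon>9 \<le> 1 / 2"
  proof -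
    have "0 \<le> 1 / t" using t by simp
    then have "(1 - 1 / t) / 2 \<le> 1 / 2" by simp
    with \<epsilon>9_le show ?thesis by (rule order_trans)
  qed
  have \<epsilon>9_\<epsilon>8: "4 * \<epsilon>9 \<le> \<epsilon>8"
  proof -
    \<comment> \<open>Completing the square in \<open>4 * (t - 1) \<le> t * (t + 1)\<close>.\<close>
    have "0 \<le> (t - 3 / 2)\<^sup>2 + 7 / 4" by simp
    then have "2 * (t - 1) \<le> (t + 1) / 2 * t" by (simp add: power2_eq_square field_simps)
    then have "2 * (1 - 1 / t) \<le> (t + 1) / 2" using t by (simp add: field_simps)
    then show ?thesis using \<epsilon>9_le \<epsilon>8 by simp
  qed
  have \<epsilon>_le: "\<epsilon> \<le> \<epsilon>10" unfolding \<epsilon>_def using \<epsilon>10 \<epsilon>8_1 by (simp add: pos_divide_le_eq)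
  have \<epsilon>0: "0 < \<epsilon>" unfolding \<epsilon>_def using \<epsilon>10 \<epsilon>8_1 by simp
  \<comment> \<open>This keeps the factor \<open>1 - \<epsilon>\<close> positive in the induction.
    The bound is a quadratic polynomial in \<open>\<eta> * \<beta>\<close> with maximum
    \<open>1 / 8\<close>.\<close>
  have \<epsilon>_less_1: "\<epsilon> < 1"
  proof -
    have "0 \<le> \<alpha> / (2 * \<beta>\<^sup>2)" "0 \<le> 1 / (2 * \<beta> * rho2 L)" using \<alpha> \<beta> r2 by (simp_all add: r2_def)
    then have "\<epsilon>3 \<le> \<beta>" unfolding \<epsilon>3_def by linarith
    moreover have "\<eta> * (2 * \<beta>\<^sup>2) \<le> \<eta> * \<epsilon>4" using eta(1) by (simp add: \<epsilon>4_def)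
    ultimately have "\<eta> * (\<epsilon>3 - \<eta> * \<epsilon>4) \<le> \<eta> * (\<beta> - \<eta> * (2 * \<beta>\<^sup>2))"
      using eta(1) by (intro mult_left_mono) linarith+
    also have "\<dots> = 1 / 8 - 2 * (\<eta> * \<beta> - 1 / 4)\<^sup>2" by (simp add: power2_eq_square algebra_simps)
    also have "\<dots> < 1" using zero_le_power2[of "\<eta> * \<beta> - 1 / 4"] by linarith
    finally show ?thesis using \<epsilon>_le \<epsilon>10_le(2) by simp
  qed

  \<comment> \<open>The average objective and its minimizers\<close>
  have gradf: "(f has_derivative (\<lambda>h. gf y \<bullet> h)) (at y)" for y
  proof -
    have "((\<lambda>y. (1 / n) * (\<Sum>i\<in>UNIV. fi i y)) has_derivative (\<lambda>h. (1 / n) * (\<Sum>i\<in>UNIV. gfi i y \<bullet> h))) (at y)"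
      using grad by (intro has_derivative_mult_right has_derivative_sum) blast
    then show ?thesis by (simp add: f_def gf_def n_def inner_sum_left)
  qed
  have lipf: "norm (gf y - gf z) \<le> Lf * norm (y - z)" for y z
  proof -
    have "norm (gf y - gf z) = (1 / n) * norm (\<Sum>i\<in>UNIV. gfi i y - gfi i z)"
      using n by (simp add: gf_def n_def sum_subtractf flip: scaleR_diff_right)
    also have "\<dots> \<le> (1 / n) * (\<Sum>i\<in>(UNIV :: 'n set). Lf * norm (y - z))"
      using n A3 by (intro mult_left_mono sum_norm_le) auto
    also have "\<dots> = Lf * norm (y - z)" using n by (simp add: n_def)
    finally show ?thesis .
  qed
  obtain ystar where ystar: "\<And>z. f ystar \<le> f z" using A2 unfolding Xstar_def by blast
  have fstar: "fstar = f ystar" unfolding fstar_def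
    by (rule antisym[OF cINF_lower cINF_greatest]) (use ystar in \<open>auto intro!: bdd_belowI2\<close>)
  have flow: "fstar \<le> f y" for y using ystar fstar by simp
  have Xstar: "Xstar = {y. f y = fstar}" unfolding Xstar_def using ystar fstar by (auto intro: antisym)
  have PL: "(1 / 2) * (norm (gf y))\<^sup>2 \<ge> \<nu> * (f y - fstar)" for y using A4(2) by blast

  \<comment> \<open>The Laplacian and its inverse on mean-zero vectors\<close>
  obtain Q :: "'a^'n \<Rightarrow> 'a^'n" where Q: "linear Q" "\<And>Y. Y \<in> mean_zero \<Longrightarrow> Q Y \<in> mean_zero"
    "\<And>Y. Y \<in> mean_zero \<Longrightarrow> lap_op a (Q Y) = Y" "\<And>X. X \<in> mean_zero \<Longrightarrow> Q (lap_op a X) = X"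
    using lap_op_inverse[of a, OF sym a0 A1] by blast
  note sa = lap_op_selfadjoint[of a, OF sym]
  have lap_mz: "lap_op a X \<in> mean_zero" for X :: "'a^'n"
    using sum_lap_op[of a, OF sym, of X] by (simp add: mean_zero_def)
  have low: "r2 * (X \<bullet> X) \<le> X \<bullet> lap_op a X" if "X \<in> mean_zero" for X :: "'a^'n"
    unfolding r2_def L_def by (rule rho2_le_lap_op[of a, OF sym a0 A1 n2 that])
  have up: "X \<bullet> lap_op a X \<le> r * (X \<bullet> X)" "lap_op a X \<bullet> lap_op a X \<le> r\<^sup>2 * (X \<bullet> X)" for X :: "'a^'n"
    unfolding r_def L_def by (rule lap_op_le_rho[of a, OF sym a0])+
  have Q_sym: "Y \<bullet> Q Z = Q Y \<bullet> Z" if "Y \<in> mean_zero" "Z \<in> mean_zero" for Y Z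
    using sa[of "Q Y" "Q Z"] Q(3)[OF that(1)] Q(3)[OF that(2)] by simp
  have Q_pos: "0 \<le> Y \<bullet> Q Y" if "Y \<in> mean_zero" for Y
    using lap_op_psd[of a, OF sym a0, of "Q Y"] Q(3)[OF that] by (simp add: inner_commute)
  have Q_bound: "Q Y \<bullet> Q Y \<le> (Y \<bullet> Y) / r2\<^sup>2" "Y \<bullet> Q Y \<le> (Y \<bullet> Y) / r2" if Y: "Y \<in> mean_zero" for Y
  proof -
    have 1: "r2 * (Q Y \<bullet> Q Y) \<le> Y \<bullet> Q Y"
      using low[OF Q(2)[OF Y]] Q(3)[OF Y] by (simp add: inner_commute)
    \<comment> \<open>With this weight half of \<open>r2 * (Q Y \<bullet> Q Y)\<close> can be
      absorbed by the first inequality.\<close>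
    have 2: "Y \<bullet> Q Y \<le> 1 / (2 * r2) * (Y \<bullet> Y) + r2 / 2 * (Q Y \<bullet> Q Y)"
      using young(1)[of "1 / r2" Y "Q Y"] r2 by simp
    have "r2 * (r2 * (Q Y \<bullet> Q Y)) \<le> Y \<bullet> Y"
      using mult_left_mono[OF order_trans[OF 1 2], of "2 * r2"] r2 by (simp add: algebra_simps)
    then show "Q Y \<bullet> Q Y \<le> (Y \<bullet> Y) / r2\<^sup>2" using r2 by (simp add: pos_le_divide_eq power2_eq_square mult_ac)
    have "Y \<bullet> Q Y \<le> 1 / r2 * (Y \<bullet> Y)" using 1 2 by simp
    then show "Y \<bullet> Q Y \<le> (Y \<bullet> Y) / r2" by simp
  qed

  \<comment> \<open>Recursions for the centred variables\<close>
  define X where "X k = (\<chi> i. x k i - xbar k)" for k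
  \<comment> \<open>Only the gradients are centred here, since the \<open>v k i\<close> sum to zero
    over \<open>i\<close> for every \<open>k\<close>.\<close>
  define W where "W k = (\<chi> i. v k i + (1 / \<beta>) *\<^sub>R (gfi i (xbar k) - gf (xbar k)))" for k
  define gh where "gh k = (1 / n) *\<^sub>R (\<Sum>i\<in>UNIV. gfi i (x k i))" for k
  \<comment> \<open>\<open>d\<close> is the centred error of evaluating gradients away from the
    mean, \<open>e\<close> the centred drift of the gradients as the mean moves.\<close>
  define d where "d k = (\<chi> i. (gfi i (x k i) - gfi i (xbar k)) - (gh k - gf (xbar k)))" for k
  define e where "e k = (\<chi> i. (gfi i (xbar (Suc k)) - gfi i (xbar k)) - (gf (xbar (Suc k)) - gf (xbar k)))" for k
  have sum_gf: "(\<Sum>i\<in>UNIV. gfi i y) = n *\<^sub>R gf y" for y using n by (simp add: gf_def n_def)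
  have Lx: "(\<Sum>j\<in>UNIV. (L $ i $ j) *\<^sub>R x k j) = lap_op a (X k) $ i" for i k
  proof -
    have "(\<Sum>j\<in>UNIV. (L $ i $ j) *\<^sub>R x k j) = lap_op a (\<chi> i. x k i) $ i" by (simp add: lap_op_def L_def)
    then show ?thesis by (simp add: lap_op_nth X_def)
  qed
  have sum_lap: "(\<Sum>i\<in>UNIV. lap_op a Y $ i) = 0" for Y :: "'a^'n" by (rule sum_lap_op[of a, OF sym])
  have sum_v: "(\<Sum>i\<in>UNIV. v k i) = 0" for k
    by (induction k) (simp_all add: v0 vstep Lx sum.distrib sum_lap flip: scaleR_sum_right)
  have xbar_step: "xbar (Suc k) = xbar k - \<eta> *\<^sub>R gh k" for k
  proof -
    have "(\<Sum>i\<in>UNIV. x (Suc k) i) = (\<Sum>i\<in>UNIV. x k i) - \<eta> *\<^sub>R (\<Sum>i\<in>UNIV. gfi i (x k i))"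
      by (simp add: xstep Lx sum_subtractf sum.distrib sum_lap sum_v flip: scaleR_sum_right)
    then show ?thesis by (simp add: xbar_def gh_def n_def scaleR_diff_right mult.commute)
  qed
  have mzX: "X k \<in> mean_zero" for k
    by (simp add: mean_zero_def X_def sum_subtractf xbar_def sum_constant_scaleR)
  have mzW: "W k \<in> mean_zero" for k
    using sum_v[of k] by (simp add: mean_zero_def W_def sum.distrib sum_subtractf sum_gf n_def sum_constant_scaleR flip: scaleR_sum_right)
  have mze: "e k \<in> mean_zero" for k
    by (simp add: mean_zero_def e_def sum_subtractf sum_gf n_def sum_constant_scaleR scaleR_diff_right)
  have X_step: "X (Suc k) = X k - \<eta> *\<^sub>R (\<alpha> *\<^sub>R lap_op a (X k) + \<beta> *\<^sub>R W k + d k)" for k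
    using \<beta> by (simp add: vec_eq_iff X_def[of "Suc k"] xstep Lx xbar_step)
      (simp add: X_def W_def d_def algebra_simps)
  have W_step: "W (Suc k) = W k + (\<eta> * \<beta>) *\<^sub>R lap_op a (X k) + (1 / \<beta>) *\<^sub>R e k" for k
    by (simp add: vec_eq_iff W_def vstep Lx e_def algebra_simps)
  \<comment> \<open>\<open>Q\<close> undoes the Laplacian, so the increment is \<open>X k\<close>
    itself, as \<open>lyap_step_identity\<close> expects.\<close>
  have QW_step: "Q (W (Suc k)) = Q (W k) + (\<eta> * \<beta>) *\<^sub>R X k + (1 / \<beta>) *\<^sub>R Q (e k)" for k
    by (simp add: W_step linear_add[OF Q(1)] linear_scale[OF Q(1)] Q(4)[OF mzX])

  \<comment> \<open>Gradient errors and descent of the objective\<close>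
  have vec_norm: "Y \<bullet> Y = (\<Sum>i\<in>UNIV. (norm (Y $ i))\<^sup>2)" for Y :: "'a^'n"
    by (simp add: inner_vec_def dot_square_norm)
  have XX: "X k \<bullet> X k = (\<Sum>i\<in>UNIV. (norm (x k i - xbar k))\<^sup>2)" for k
    by (simp add: vec_norm X_def)
  \<comment> \<open>The errors \<open>?u i\<close> split orthogonally into the centred part
    \<open>d\<close> and their mean, so one Lipschitz estimate bounds both together.\<close>
  have dD: "d k \<bullet> d k + n * (norm (gh k - gf (xbar k)))\<^sup>2 \<le> Lf\<^sup>2 * (X k \<bullet> X k)" for k
  proof -
    let ?u = "\<lambda>i. gfi i (x k i) - gfi i (xbar k)"
    have m: "(1 / real CARD('n)) *\<^sub>R (\<Sum>i\<in>UNIV. ?u i) = gh k - gf (xbar k)"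
      by (simp add: gh_def gf_def n_def sum_subtractf scaleR_diff_right)
    have "d k \<bullet> d k + n * (norm (gh k - gf (xbar k)))\<^sup>2 = (\<Sum>i\<in>UNIV. (norm (?u i))\<^sup>2)"
      using sum_norm_sq_diff_mean[of ?u 0] unfolding m by (simp add: vec_norm d_def n_def)
    also have "\<dots> \<le> (\<Sum>i\<in>UNIV. (Lf * norm (x k i - xbar k))\<^sup>2)"
      using A3 by (intro sum_mono power_mono) auto
    also have "\<dots> = Lf\<^sup>2 * (X k \<bullet> X k)" by (simp add: XX power_mult_distrib sum_distrib_left)
    finally show ?thesis .
  qed
  define G where "G k = n * (norm (gh k))\<^sup>2" for k
  have ee: "e k \<bullet> e k \<le> \<eta>\<^sup>2 * Lf\<^sup>2 * G k" for k
  proof -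
    let ?u = "\<lambda>i. gfi i (xbar (Suc k)) - gfi i (xbar k)"
    have m: "(1 / real CARD('n)) *\<^sub>R (\<Sum>i\<in>UNIV. ?u i) = gf (xbar (Suc k)) - gf (xbar k)"
      by (simp add: gf_def sum_subtractf scaleR_diff_right)
    have "e k \<bullet> e k + n * (norm (gf (xbar (Suc k)) - gf (xbar k)))\<^sup>2 = (\<Sum>i\<in>UNIV. (norm (?u i))\<^sup>2)"
      using sum_norm_sq_diff_mean[of ?u 0] unfolding m by (simp add: vec_norm e_def n_def)
    then have "e k \<bullet> e k \<le> (\<Sum>i\<in>UNIV. (norm (?u i))\<^sup>2)" using n by (smt (verit) mult_nonneg_nonneg zero_le_power2)
    also have "\<dots> \<le> (\<Sum>i\<in>(UNIV :: 'n set). (Lf * norm (xbar (Suc k) - xbar k))\<^sup>2)"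
      using A3 by (intro sum_mono power_mono) auto
    also have "\<dots> = \<eta>\<^sup>2 * Lf\<^sup>2 * G k" by (simp add: xbar_step power_mult_distrib G_def n_def)
    finally show ?thesis .
  qed
  define F where "F k = n * (f (xbar k) - fstar)" for k
  have F0: "0 \<le> F k" for k using flow n by (simp add: F_def)
  have F_step: "F (Suc k) \<le> F k - \<eta> / 2 * (G k + n * (norm (gf (xbar k)))\<^sup>2 - n * (norm (gh k - gf (xbar k)))\<^sup>2)
      + Lf / 2 * \<eta>\<^sup>2 * G k" for k
  proof -
    have "f (xbar (Suc k)) \<le> f (xbar k) - \<eta> * (gf (xbar k) \<bullet> gh k) + Lf / 2 * (\<eta>\<^sup>2 * (norm (gh k))\<^sup>2)"
      using lipschitz_gradient_upper_bound[OF gradf lipf, of "xbar (Suc k)" "xbar k"]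
      by (simp add: xbar_step power_mult_distrib)
    \<comment> \<open>Polarization keeps both squares: that of \<open>gh\<close> absorbs the
      \<open>e\<close> terms, that of \<open>gf\<close> feeds the Polyak--Lojasiewicz
      condition.\<close>
    moreover have "gf (xbar k) \<bullet> gh k = ((norm (gh k))\<^sup>2 + (norm (gf (xbar k)))\<^sup>2 - (norm (gh k - gf (xbar k)))\<^sup>2) / 2"
      by (simp add: power2_norm_eq_inner inner_diff inner_commute)
    ultimately have "f (xbar (Suc k)) - fstar \<le> f (xbar k) - fstar
        - \<eta> / 2 * ((norm (gh k))\<^sup>2 + (norm (gf (xbar k)))\<^sup>2 - (norm (gh k - gf (xbar k)))\<^sup>2) + Lf / 2 * (\<eta>\<^sup>2 * (norm (gh k))\<^sup>2)"
      by simp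
    from mult_left_mono[OF this, of n] show ?thesis using n by (simp add: F_def G_def algebra_simps)
  qed
  have G0: "2 * \<nu> * F k \<le> n * (norm (gf (xbar k)))\<^sup>2" for k
    using mult_left_mono[OF PL[of "xbar k"], of "2 * n"] n by (simp add: F_def mult_ac)

  \<comment> \<open>Contraction of the Lyapunov function\<close>
  define U where "U k = lyap t (X k) (W k) (Q (W k))" for k
  \<comment> \<open>Weight 1 would give the first claim; the second one needs at least \<open>4 * \<epsilon>9\<close>, because
    quadratic growth only yields \<open>n * dist\<^sup>2 \<le> 2 / \<nu> * F\<close>.\<close>
  define m where "m = max 1 (4 * \<epsilon>9)"
  have m: "1 \<le> m" "m \<le> 2" "m \<le> \<epsilon>8" "4 * \<epsilon>9 \<le> m"
    using \<epsilon>9_half \<epsilon>8_1 \<epsilon>9_\<epsilon>8 by (simp_all add: m_def)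
  have descent: "U (Suc k) + m * F (Suc k) \<le> U k + m * F k - \<eta> * (\<epsilon>1 - \<eta> * \<epsilon>2) * (X k \<bullet> X k)
      - \<eta> * (\<epsilon>3 - \<eta> * \<epsilon>4) * (W k \<bullet> W k) - \<eta> * \<nu> * (m * F k)" for k
    unfolding \<epsilon>1_def \<epsilon>2_def \<epsilon>3_def \<epsilon>4_def r_def[symmetric] r2_def[symmetric]
  proof (rule lyap_combined_descent[OF \<beta> eta(1) r2 \<alpha> Lf0 m(1,2) _ _ F_step dD ee G0])
    show "U (Suc k) \<le> U k
         - \<eta> * ((\<alpha> - \<beta>) * r2 - 1 - \<eta> * (\<beta>\<^sup>2 * r + (2 * \<alpha>\<^sup>2 + \<beta>\<^sup>2) * r\<^sup>2)) * (X k \<bullet> X k)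
         - \<eta> * (\<beta> - 1 / 2 - \<alpha> / (2 * \<beta>\<^sup>2) - 1 / (2 * \<beta> * r2) - \<eta> * (2 * \<beta>\<^sup>2 + 1 / 2)) * (W k \<bullet> W k)
         + (\<eta> + 5 / 2 * \<eta>\<^sup>2) * (d k \<bullet> d k)
         + ((1 / (2 * \<beta>)) * (1 / \<beta> + 1 / r2 + \<alpha> / \<beta>) / \<eta> + (1 / \<beta>\<^sup>2) * (1 + 1 / r2 + \<alpha> / \<beta>) + 1 / 2) * (e k \<bullet> e k)"
      unfolding U_def t_def X_step W_step[of k] QW_step[of k, unfolded W_step[of k]]
    proof (rule lyap_step_bound)
      show "lap_op a (X k) \<bullet> Q (W k) = X k \<bullet> W k"
        using sa[of "X k" "Q (W k)"] Q(3)[OF mzW] by simp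
      show "e k \<bullet> Q (W k) = W k \<bullet> Q (e k)"
        using Q_sym[OF mze mzW] by (simp add: inner_commute)
      show "lap_op a (X k) \<bullet> Q (e k) = X k \<bullet> e k"
        using sa[of "X k" "Q (e k)"] Q(3)[OF mze] by simp
    qed (use \<beta> eta(1) r2 \<alpha>\<beta> low[OF mzX] up Q_bound[OF mze] in simp_all)
    show "\<eta> * ((1 / \<beta>\<^sup>2) * (1 + 1 / r2 + \<alpha> / \<beta>) * Lf\<^sup>2 + Lf * (1 + Lf) / 2)
        \<le> 1 / 4 - (1 / (2 * \<beta>)) * (1 / \<beta> + 1 / r2 + \<alpha> / \<beta>) * Lf\<^sup>2"
      using d5 by (simp add: \<epsilon>5_def \<epsilon>6_def r2_def)
  qed (use n in \<open>simp_all add: G_def\<close>)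
  have U_upper: "U k \<le> \<epsilon>8 * (X k \<bullet> X k + W k \<bullet> W k)" for k
    unfolding U_def \<epsilon>8_eq using t r2 Q_bound(2)[OF mzW] by (intro lyap_upper) simp_all
  have U_lower: "\<epsilon>9 * (X k \<bullet> X k) \<le> U k" for k
    using lyap_lower[of t "W k" "Q (W k)" "X k"] t Q_pos[OF mzW] mult_right_mono[OF \<epsilon>9_le, of "X k \<bullet> X k"]
    by (simp add: U_def)
  \<comment> \<open>\<open>U_upper\<close> turns the decrease in \<open>X\<close> and
    \<open>W\<close> into \<open>\<epsilon> * U k\<close>, because
    \<open>\<epsilon> = \<epsilon>10 / \<epsilon>8\<close>; the \<open>F\<close> part has room since
    \<open>\<epsilon> \<le> \<epsilon>10 \<le> \<eta> * (\<nu> / 2)\<close>.\<close>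
  have contraction: "U (Suc k) + m * F (Suc k) \<le> (1 - \<epsilon>) * (U k + m * F k)" for k
  proof -
    have "\<epsilon>10 * (X k \<bullet> X k) \<le> \<eta> * (\<epsilon>1 - \<eta> * \<epsilon>2) * (X k \<bullet> X k)"
      "\<epsilon>10 * (W k \<bullet> W k) \<le> \<eta> * (\<epsilon>3 - \<eta> * \<epsilon>4) * (W k \<bullet> W k)"
      using \<epsilon>10_le by (intro mult_right_mono; simp)+
    moreover have "\<epsilon> * (m * F k) \<le> \<eta> * \<nu> * (m * F k)"
    proof (rule mult_right_mono)
      have "\<eta> * (\<nu> / 2) \<le> \<eta> * \<nu>" using eta(1) A4(1) by simp
      then show "\<epsilon> \<le> \<eta> * \<nu>" using \<epsilon>_le \<epsilon>10_le(3) by linarith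
    qed (use m F0 in simp)
    moreover have "\<epsilon> * U k \<le> \<epsilon>10 * (X k \<bullet> X k + W k \<bullet> W k)"
      using mult_left_mono[OF U_upper, of \<epsilon> k] \<epsilon>0 \<epsilon>8_1 by (simp add: \<epsilon>_def)
    ultimately show ?thesis using descent[of k] by (simp add: algebra_simps)
  qed
  have V0: "V0 = X 0 \<bullet> X 0 + W 0 \<bullet> W 0 + F 0"
  proof -
    have "Knorm2 (x 0) = X 0 \<bullet> X 0" by (simp add: Knorm2_def XX xbar_def)
    moreover have "Knorm2 (\<lambda>i. v 0 i + (1 / \<beta>) *\<^sub>R gfi i (xbar 0)) = W 0 \<bullet> W 0"
    proof -
      have "(1 / real CARD('n)) *\<^sub>R (\<Sum>i\<in>UNIV. v 0 i + (1 / \<beta>) *\<^sub>R gfi i (xbar 0)) = (1 / \<beta>) *\<^sub>R gf (xbar 0)"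
        by (simp add: sum.distrib v0 gf_def mult.commute flip: scaleR_sum_right)
      then show ?thesis unfolding Knorm2_def vec_norm by (simp add: W_def scaleR_diff_right algebra_simps)
    qed
    ultimately show ?thesis by (simp add: V0_def F_def n_def)
  qed
  have decay: "U k + m * F k \<le> (1 - \<epsilon>) ^ k * (\<epsilon>8 * V0)" for k
  proof (induction k)
    case 0
    \<comment> \<open>The admissibility bound \<open>m \<le> \<epsilon>8\<close> is used
      here.\<close>
    have "m * F 0 \<le> \<epsilon>8 * F 0" using m F0 by (intro mult_right_mono) simp_all
    then show ?case using U_upper[of 0] by (simp add: V0 algebra_simps)
  next
    case (Suc k)
    have "(1 - \<epsilon>) * (U k + m * F k) \<le> (1 - \<epsilon>) * ((1 - \<epsilon>) ^ k * (\<epsilon>8 * V0))"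
      using Suc \<epsilon>_less_1 by (intro mult_left_mono) simp_all
    then show ?case using contraction[of k] by simp
  qed
  have c_eq: "(1 - \<epsilon>) ^ k * (\<epsilon>8 * V0) = \<epsilon>9 * ((1 - \<epsilon>) ^ k * c)" for k
    using \<epsilon>9 by (simp add: c_def)
  have key: "\<epsilon>9 * (X k \<bullet> X k) + m * F k \<le> \<epsilon>9 * ((1 - \<epsilon>) ^ k * c)" for k
    using decay[of k] U_lower[of k] unfolding c_eq by simp
  have first: "X k \<bullet> X k + F k \<le> (1 - \<epsilon>) ^ k * c" for k
  proof -
    have "\<epsilon>9 * F k \<le> m * F k" using m \<epsilon>9_half F0 by (intro mult_right_mono) simp_all
    then have "\<epsilon>9 * (X k \<bullet> X k + F k) \<le> \<epsilon>9 * ((1 - \<epsilon>) ^ k * c)" using key[of k] by (simp add: algebra_simps)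
    then show ?thesis using \<epsilon>9 by simp
  qed

  \<comment> \<open>Distance to the set of minimizers\<close>
  have second: "(\<Sum>i\<in>UNIV. (norm (x k i - P (xbar k)))\<^sup>2) \<le> (1 - \<epsilon>) ^ k * c * (1 + 1 / (2 * \<nu>))"
    if proj: "\<forall>y. \<exists>!p. p \<in> Xstar \<and> (\<forall>z\<in>Xstar. (norm (y - p))\<^sup>2 \<le> (norm (y - z))\<^sup>2)" for k
  proof -
    let ?p = "P (xbar k)" and ?R = "(1 - \<epsilon>) ^ k * c"
    \<comment> \<open>The \<open>THE\<close> in \<open>P\<close> denotes the projection by the
      uniqueness in \<open>proj\<close>.\<close>
    have p: "?p \<in> Xstar \<and> (\<forall>z\<in>Xstar. (norm (xbar k - ?p))\<^sup>2 \<le> (norm (xbar k - z))\<^sup>2)"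
      unfolding P_def by (rule theI') (use proj in blast)
    have "\<nu> / 2 * (norm (xbar k - ?p))\<^sup>2 \<le> f (xbar k) - fstar"
      by (rule PL_quadratic_growth[OF gradf flow PL A4(1)]) (use p in \<open>auto simp: Xstar\<close>)
    then have "n * (\<nu> / 2 * (norm (xbar k - ?p))\<^sup>2) \<le> F k"
      unfolding F_def using n by (intro mult_left_mono) simp_all
    then have qg: "n * (norm (xbar k - ?p))\<^sup>2 \<le> 2 / \<nu> * F k" using A4(1) by (simp add: field_simps)
    \<comment> \<open>The weight leaves \<open>4 * F k\<close> beside
      \<open>X k \<bullet> X k\<close>, so \<open>2 / \<nu> * F k\<close> costs only the share
      \<open>1 / (2 * \<nu>)\<close> of \<open>?R\<close>.\<close>
    have "4 * \<epsilon>9 * F k \<le> m * F k" using m F0 by (intro mult_right_mono) simp_all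
    then have "\<epsilon>9 * (X k \<bullet> X k + 4 * F k) \<le> \<epsilon>9 * ?R" using key[of k] by (simp add: algebra_simps)
    then have four: "X k \<bullet> X k + 4 * F k \<le> ?R" using \<epsilon>9 by simp
    have xx: "0 \<le> X k \<bullet> X k" by simp
    have "1 / (2 * \<nu>) * (4 * F k) \<le> 1 / (2 * \<nu>) * ?R"
      using four xx A4(1) by (intro mult_left_mono) (linarith, simp)
    then have "2 / \<nu> * F k \<le> 1 / (2 * \<nu>) * ?R" by simp
    moreover have "X k \<bullet> X k \<le> ?R" using four F0[of k] by simp
    moreover have "(\<Sum>i\<in>UNIV. (norm (x k i - ?p))\<^sup>2) = X k \<bullet> X k + n * (norm (xbar k - ?p))\<^sup>2"
      using sum_norm_sq_diff_mean[of "x k" ?p] by (simp add: XX xbar_def n_def)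
    ultimately show ?thesis using qg by (simp add: algebra_simps)
  qed
  show ?thesis using first second by (simp add: XX F_def n_def)
qed

end
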